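(* Let $S$ be a finite alphabet and fix a system of relations $E$ over $S^{\pm}$. The following conditions are equivalent: (1) $E$ is testable. (2) There exist functions $k\colon\mathbb R_{>0}\to\mathbb N$, $P\colon\mathbb R_{>0}\to\mathrm{FinSubsets}(F_S)$ and $\delta\colon\mathbb R_{>0}\to\mathbb R_{>0}$ such that $\varepsilon\mapsto\mathrm{LSM}^{E}_{k(\varepsilon),P(\varepsilon),\delta(\varepsilon)}$ is a family of testers for $E$. (3) $E$ is statistically distinguishable.
   Context: Words and relations. $S=\{s_1,\dots,s_d\}$ is a finite alphabet, $S^{-}$ its set of formal inverses, $S^{\pm}=S\cup S^{-}$; $F_S$ is the set of reduced words over $S^{\pm}$ (the free group on $S$). $\mathrm{FinSubsets}(A)$ is the set of finite subsets of $A$. A system of relations $E=\{w_{i,1}=w_{i,2}\}_{i=1}^r$ over $S^{\pm}$ is a finite set of formal equations between words over $S^{\pm}$. $S$-graphs. An $S$-graph is a directed graph (self-loops and multiple edges allowed) with edges labelled by elements of $S$, such that for each $s\in S$ every vertex has exactly one outgoing and exactly one incoming edge labelled $s$. $s_Gx$ is the endpoint of the $s$-labelled edge leaving $x$, $s_G^{-1}x$ the origin of the $s$-labelled edge entering $x$; for a word $w=w_t\cdots w_1$ ($w_i\in S^{\pm}$), $w_Gx=(w_t)_G(\cdots((w_1)_Gx))$. $\mathcal G_S(n)$ is the set of $S$-graphs with vertex set $[n]=\{1,\dots,n\}$. $\mathrm{GSol}_E(n)$ is the set of $G\in\mathcal G_S(n)$ with $(w_{i,1})_Gx=(w_{i,2})_Gx$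 for all $i$ and all $x\in[n]$. For $G,G'\in\mathcal G_S(n)$, $d^{\mathrm H}(G,G')=\sum_{s\in S}\frac1n|\{x\in[n]: s_Gx\ne s_{G'}x\}|$, and for $\varepsilon>0$, $\mathrm{GSol}_E^{\ge\varepsilon}(n)=\{G\in\mathcal G_S(n): d^{\mathrm H}(G,G')\ge\varepsilon\ \forall G'\in\mathrm{GSol}_E(n)\}$. Testability. A (randomized, adaptive) algorithm that takes $n\in\mathbb N$ and has query access to $G\in\mathcal G_S(n)$ is an $(\varepsilon,q)$-tester for $E$ if: it accepts with probability at least $0.99$ whenever $G\in\mathrm{GSol}_E(n)$; it rejects with probability at least $0.99$ whenever $G\in\mathrm{GSol}_E^{\ge\varepsilon}(n)$; and it makes at most $q$ queries, each of the form "what is $s_Gx$?" with $x\in[n]$, $s\in S^{\pm}$. Running time is not restricted. If for every $\varepsilon>0$ there are $q(\varepsilon)\in\mathbb N$ (independent of $n$) and an $(\varepsilon,q(\varepsilon))$-tester $\mathcal M_\varepsilon$, then $E$ is testable and $\varepsilon\mapsto\mathcal M_\varepsilon$ is a family of testers for $E$. Local statistics. $\mathrm{Stab}_G(x)=\{w\in F_S: w_Gx=x\}$. For finite $P\subset F_S$, $N_{G,P}$ is the distribution, over subsets of $P$, of $\mathrm{Stab}_G(x)\cap P$ when $x$ is a uniformly random vertex of $G$. $d_{\mathrm{TV}}(\theta_1,\theta_2)=\frac12\sum_{x\in\Omega}|\theta_1(x)-\theta_2(x)|$ for distributions on a finite set $\Omega$. $E$ is statistically distinguishable if for every $\varepsilon>0$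 there exist $P(\varepsilon)\in\mathrm{FinSubsets}(F_S)$ and $\delta(\varepsilon)>0$ such that $d_{\mathrm{TV}}(N_{G,P(\varepsilon)},N_{H,P(\varepsilon)})\ge\delta(\varepsilon)$ for every $n\in\mathbb N$, $G\in\mathrm{GSol}_E(n)$ and $H\in\mathrm{GSol}_E^{\ge\varepsilon}(n)$. Local Statistics Matcher $\mathrm{LSM}^E_{k,P,\delta}$ ($k\in\mathbb N$, $P\in\mathrm{FinSubsets}(F_S)$, $\delta>0$): on input $n$ and $G\in\mathcal G_S(n)$, sample $x_1,\dots,x_k$ uniformly and independently from $[n]$; compute $\mathrm{Stab}_G(x_j)\cap P$ for each $j$ by querying $G$ (at most $k\sum_{w\in P}|w|$ queries); let $N^{\mathrm{Emp}}_{G,P}$ be the distribution of $\mathrm{Stab}_G(x_j)\cap P$ for $j$ uniform in $\{1,\dots,k\}$; accept if $\min\{d_{\mathrm{TV}}(N^{\mathrm{Emp}}_{G,P},N_{H,P}): H\in\mathrm{GSol}_E(n)\}\le\delta$, otherwise reject. *)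

theory Defs
  imports "HOL-Probability.Probability"
begin

datatype 's letter = Gen 's | Inv 's

primrec inv_letter :: "'s letter \<Rightarrow> 's letter" where
  "inv_letter (Gen s) = Inv s"
| "inv_letter (Inv s) = Gen s"

text \<open>The word \<open>w\<^sub>t \<dots> w\<^sub>1\<close> is the list \<open>[w\<^sub>t, \<dots>, w\<^sub>1]\<close>: words act from the left, so the last
  list element acts first.\<close>

type_synonym 's word = "'s letter list"

definition reduced_words :: "'s word set" where
  "reduced_words = {w. successively (\<lambda>a b. b \<noteq> inv_letter a) w}"

definition fin_subsets :: "'a set \<Rightarrow> 'a set set" where
  "fin_subsets A = {P. finite P \<and> P \<subseteq> A}"

text \<open>A graph is given by its edges \<open>(origin, label, endpoint)\<close>. A set suffices although multiple
  edges are allowed, as parallel edges in an \<open>S\<close>-graph carry different labels. The alphabet is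
  the whole type \<open>'s\<close>.\<close>

type_synonym 's edges = "(nat \<times> 's \<times> nat) set"

definition sgraphs :: "nat \<Rightarrow> 's edges set" where
  "sgraphs n = {G. G \<subseteq> {1..n} \<times> UNIV \<times> {1..n} \<and>
     (\<forall>s. \<forall>x\<in>{1..n}. (\<exists>!y. (x, s, y) \<in> G) \<and> (\<exists>!y. (y, s, x) \<in> G))}"

primrec letter_act :: "'s edges \<Rightarrow> 's letter \<Rightarrow> nat \<Rightarrow> nat" where
  "letter_act G (Gen s) x = (THE y. (x, s, y) \<in> G)"
| "letter_act G (Inv s) x = (THE y. (y, s, x) \<in> G)"

definition word_act :: "'s edges \<Rightarrow> 's word \<Rightarrow> nat \<Rightarrow> nat" where
  "word_act G w x = foldr (letter_act G) w x"

type_synonym 's relations = "('s word \<times> 's word) set"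

definition GSol :: "'s relations \<Rightarrow> nat \<Rightarrow> 's edges set" where
  "GSol E n = {G \<in> sgraphs n. \<forall>(u, v)\<in>E. \<forall>x\<in>{1..n}. word_act G u x = word_act G v x}"

definition hamming_dist :: "nat \<Rightarrow> ('s::finite) edges \<Rightarrow> 's edges \<Rightarrow> real" where
  "hamming_dist n G G' =
     (\<Sum>s\<in>UNIV. 1 / real n * real (card {x \<in> {1..n}. letter_act G (Gen s) x \<noteq> letter_act G' (Gen s) x}))"

definition GSol_far :: "('s::finite) relations \<Rightarrow> real \<Rightarrow> nat \<Rightarrow> 's edges set" where
  "GSol_far E \<epsilon> n = {G \<in> sgraphs n. \<forall>G'\<in>GSol E n. hamming_dist n G G' \<ge> \<epsilon>}"


text \<open>Randomized adaptive query algorithms are well-founded interaction trees: such an algorithm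
  halts with a result, or asks for the image of a vertex under a letter and continues depending on
  the answer, or draws a random number and continues depending on its value. An algorithm that takes \<open>n\<close> as input
  is a function from \<open>nat\<close> to such trees; computability in \<open>n\<close> is not part of the model.\<close>

datatype ('s, 'a) algo =
  Return 'a
| Query nat "'s letter" "nat \<Rightarrow> ('s, 'a) algo"
| Sample "nat pmf" "nat \<Rightarrow> ('s, 'a) algo"

primrec bind_algo :: "('s, 'a) algo \<Rightarrow> ('a \<Rightarrow> ('s, 'b) algo) \<Rightarrow> ('s, 'b) algo" where
  "bind_algo (Return a) f = f a"
| "bind_algo (Query x a c) f = Query x a (\<lambda>y. bind_algo (c y) f)"
| "bind_algo (Sample p c) f = Sample p (\<lambda>r. bind_algo (c r) f)"

adhoc_overloading Monad_Syntax.bind \<rightleftharpoons> bind_algo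

primrec run :: "'s edges \<Rightarrow> ('s, 'a) algo \<Rightarrow> 'a pmf" where
  "run G (Return a) = return_pmf a"
| "run G (Query x a c) = run G (c (letter_act G a x))"
| "run G (Sample p c) = bind_pmf p (\<lambda>r. run G (c r))"

text \<open>On the graph \<open>G\<close> with vertex set \<open>{1..n}\<close>, every possible execution makes at most \<open>q\<close>
  queries, all of them at vertices of \<open>G\<close>.\<close>

primrec queries_at_most :: "nat \<Rightarrow> 's edges \<Rightarrow> nat \<Rightarrow> ('s, 'a) algo \<Rightarrow> bool" where
  "queries_at_most n G q (Return a) \<longleftrightarrow> True"
| "queries_at_most n G q (Query x a c) \<longleftrightarrow>
     x \<in> {1..n} \<and> 0 < q \<and> queries_at_most n G (q - 1) (c (letter_act G a x))"
| "queries_at_most n G q (Sample p c) \<longleftrightarrow> (\<forall>r\<in>set_pmf p. queries_at_most n G q (c r))"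

text \<open>Here and below \<open>n\<close> ranges over the positive integers: for \<open>n = 0\<close> neither the normalized
  Hamming distance nor a uniformly random vertex makes sense.\<close>

definition is_tester ::
  "('s::finite) relations \<Rightarrow> real \<Rightarrow> nat \<Rightarrow> (nat \<Rightarrow> ('s, bool) algo) \<Rightarrow> bool" where
  "is_tester E \<epsilon> q M \<longleftrightarrow> (\<forall>n\<ge>1.
     (\<forall>G\<in>GSol E n. pmf (run G (M n)) True \<ge> 0.99) \<and>
     (\<forall>G\<in>GSol_far E \<epsilon> n. pmf (run G (M n)) False \<ge> 0.99) \<and>
     (\<forall>G\<in>sgraphs n. queries_at_most n G q (M n)))"

definition family_of_testers ::
  "('s::finite) relations \<Rightarrow> (real \<Rightarrow> nat \<Rightarrow> ('s, bool) algo) \<Rightarrow> bool" where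
  "family_of_testers E M \<longleftrightarrow> (\<forall>\<epsilon>>0. \<exists>q. is_tester E \<epsilon> q (M \<epsilon>))"

definition testable :: "('s::finite) relations \<Rightarrow> bool" where
  "testable E \<longleftrightarrow> (\<exists>M. family_of_testers E M)"


definition stab :: "'s edges \<Rightarrow> nat \<Rightarrow> 's word set" where
  "stab G x = {w \<in> reduced_words. word_act G w x = x}"

definition stat :: "nat \<Rightarrow> 's edges \<Rightarrow> 's word set \<Rightarrow> 's word set pmf" where
  "stat n G P = map_pmf (\<lambda>x. stab G x \<inter> P) (pmf_of_set {1..n})"

definition tv_dist :: "'a set \<Rightarrow> 'a pmf \<Rightarrow> 'a pmf \<Rightarrow> real" where
  "tv_dist \<Omega> \<theta>\<^sub>1 \<theta>\<^sub>2 = 1 / 2 * (\<Sum>x\<in>\<Omega>. \<bar>pmf \<theta>\<^sub>1 x - pmf \<theta>\<^sub>2 x\<bar>)"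

definition statistically_distinguishable :: "('s::finite) relations \<Rightarrow> bool" where
  "statistically_distinguishable E \<longleftrightarrow>
     (\<forall>\<epsilon>>0. \<exists>P\<in>fin_subsets reduced_words. \<exists>\<delta>>0. \<forall>n\<ge>1. \<forall>G\<in>GSol E n. \<forall>H\<in>GSol_far E \<epsilon> n.
        tv_dist (Pow P) (stat n G P) (stat n H P) \<ge> \<delta>)"


primrec sample_vertices :: "nat \<Rightarrow> nat \<Rightarrow> ('s, nat list) algo" where
  "sample_vertices n 0 = Return []"
| "sample_vertices n (Suc k) = Sample (pmf_of_set {1..n}) (\<lambda>x. do {
     xs \<leftarrow> sample_vertices n k;
     Return (x # xs) })"

primrec query_word :: "'s word \<Rightarrow> nat \<Rightarrow> ('s, nat) algo" where
  "query_word [] x = Return x"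
| "query_word (a # w) x = do { y \<leftarrow> query_word w x; Query y a Return }"

primrec query_stab :: "'s word list \<Rightarrow> nat \<Rightarrow> ('s, 's word set) algo" where
  "query_stab [] x = Return {}"
| "query_stab (w # ws) x = do {
     y \<leftarrow> query_word w x;
     T \<leftarrow> query_stab ws x;
     Return (if y = x then insert w T else T) }"

primrec query_stabs :: "'s word list \<Rightarrow> nat list \<Rightarrow> ('s, 's word set list) algo" where
  "query_stabs ws [] = Return []"
| "query_stabs ws (x # xs) = do {
     T \<leftarrow> query_stab ws x;
     Ts \<leftarrow> query_stabs ws xs;
     Return (T # Ts) }"

definition empirical :: "'a list \<Rightarrow> 'a pmf" where
  "empirical Ts = map_pmf (\<lambda>j. Ts ! j) (pmf_of_set {..<length Ts})"

text \<open>The order in which the words of \<open>P\<close> are queried is immaterial and left unspecified.\<close>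

definition LSM ::
  "('s::finite) relations \<Rightarrow> nat \<Rightarrow> 's word set \<Rightarrow> real \<Rightarrow> nat \<Rightarrow> ('s, bool) algo" where
  "LSM E k P \<delta> n = do {
     xs \<leftarrow> sample_vertices n k;
     Ts \<leftarrow> query_stabs (SOME ws. distinct ws \<and> set ws = P) xs;
     Return (Min ((\<lambda>H. tv_dist (Pow P) (empirical Ts) (stat n H P)) ` GSol E n) \<le> \<delta>) }"

text \<open>The minimum ranges over a finite nonempty set, as the graph consisting of loops solves every
  system of relations.\<close>

lemma finite_GSol: "finite (GSol (E :: ('s::finite) relations) n)"
proof (rule finite_subset)
  show "GSol E n \<subseteq> Pow ({1..n} \<times> UNIV \<times> {1..n})"
    by (auto simp: GSol_def sgraphs_def)
qed auto

lemma GSol_nonempty: "GSol E n \<noteq> {}"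
proof -
  define G :: "'a edges" where "G = {(x, s, x) | x s. x \<in> {1..n}}"
  have act: "letter_act G a x = x" if "x \<in> {1..n}" for a x
    using that by (cases a) (auto simp: G_def)
  have "word_act G w x = x" if "x \<in> {1..n}" for w x
    unfolding word_act_def by (induction w) (simp_all add: act[OF that])
  moreover have "G \<in> sgraphs n"
    by (auto simp: sgraphs_def G_def)
  ultimately have "G \<in> GSol E n"
    by (auto simp: GSol_def)
  then show ?thesis by blast
qed

end

theory Submission
  imports Defs
begin

text \<open>A statistically distinguishable system is tested by the matcher because the empirical
  distribution of sufficiently many samples is close to the true one, by the second moment method.

  Conversely, a tester with \<open>q\<close> queries may be run on a uniformly random relabelling of the input,
  as solutions and far graphs are closed under relabelling. If the statistics of \<open>G\<close> and \<open>H\<close> with respect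
  to the words of length at most \<open>2q\<close> are close, then after relabelling \<open>H\<close> most vertices have the same
  local type in both graphs. The relabelling is then revealed query by query, in parallel for \<open>G\<close>
  and \<open>H\<close>: except with small probability, each freshly revealed vertex is of the same type in both
  graphs and far from what was seen before when \<open>n\<close> is large, so the tester cannot tell the two graphs
  apart. For the finitely many small \<open>n\<close> the statistics of the relators themselves
  separate solutions from non-solutions by at least \<open>1/(2n)\<close>.\<close>

section \<open>Words acting on the vertices of an S-graph\<close>

lemma sgraph_letter_act_Gen_eq_iff:
  assumes "G \<in> sgraphs n" "x \<in> {1..n}"
  shows "letter_act G (Gen s) x = y \<longleftrightarrow> (x, s, y) \<in> G"
proof -
  have "\<exists>!y. (x, s, y) \<in> G" using assms by (auto simp: sgraphs_def)
  then show ?thesis by (auto intro: theI' the1_equality)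
qed

lemma sgraph_letter_act_Inv_eq_iff:
  assumes "G \<in> sgraphs n" "x \<in> {1..n}"
  shows "letter_act G (Inv s) x = y \<longleftrightarrow> (y, s, x) \<in> G"
proof -
  have "\<exists>!y. (y, s, x) \<in> G" using assms by (auto simp: sgraphs_def)
  then show ?thesis by (auto intro: theI' the1_equality)
qed

lemma letter_act_in:
  assumes "G \<in> sgraphs n" "x \<in> {1..n}"
  shows "letter_act G a x \<in> {1..n}"
proof -
  have sub: "G \<subseteq> {1..n} \<times> UNIV \<times> {1..n}" using assms(1) by (simp add: sgraphs_def)
  show ?thesis
  proof (cases a)
    case (Gen s)
    then have "(x, s, letter_act G a x) \<in> G"
      using sgraph_letter_act_Gen_eq_iff[OF assms] by blast
    then show ?thesis using sub by blast
  next
    case (Inv s)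
    then have "(letter_act G a x, s, x) \<in> G"
      using sgraph_letter_act_Inv_eq_iff[OF assms] by blast
    then show ?thesis using sub by blast
  qed
qed

lemma inv_letter_inv_letter [simp]: "inv_letter (inv_letter a) = a"
  by (cases a) auto

lemma letter_act_inv_letter:
  assumes "G \<in> sgraphs n" "x \<in> {1..n}"
  shows "letter_act G (inv_letter a) (letter_act G a x) = x"
proof (cases a)
  case (Gen s)
  then show ?thesis
    using sgraph_letter_act_Gen_eq_iff[OF assms] letter_act_in[OF assms, of a]
      sgraph_letter_act_Inv_eq_iff[OF assms(1)] by (metis inv_letter.simps(1))
next
  case (Inv s)
  then show ?thesis
    using sgraph_letter_act_Inv_eq_iff[OF assms] letter_act_in[OF assms, of a]
      sgraph_letter_act_Gen_eq_iff[OF assms(1)] by (metis inv_letter.simps(2))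
qed

lemma word_act_Nil [simp]: "word_act G [] x = x"
  by (simp add: word_act_def)

lemma word_act_Cons [simp]: "word_act G (a # w) x = letter_act G a (word_act G w x)"
  by (simp add: word_act_def)

lemma word_act_append [simp]: "word_act G (u @ v) x = word_act G u (word_act G v x)"
  by (simp add: word_act_def)

lemma word_act_in: "G \<in> sgraphs n \<Longrightarrow> x \<in> {1..n} \<Longrightarrow> word_act G w x \<in> {1..n}"
proof (induction w)
  case (Cons a w)
  then show ?case by (metis word_act_Cons letter_act_in)
qed simp

definition inv_word :: "'s word \<Rightarrow> 's word" where
  "inv_word w = rev (map inv_letter w)"

lemma length_inv_word [simp]: "length (inv_word w) = length w"
  by (simp add: inv_word_def)

lemma inv_word_inv_word [simp]: "inv_word (inv_word w) = w"
  by (simp add: inv_word_def rev_map[symmetric] comp_def)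

lemma word_act_inv_word:
  assumes "G \<in> sgraphs n" "x \<in> {1..n}"
  shows "word_act G (inv_word w) (word_act G w x) = x"
  using assms
proof (induction w)
  case (Cons a w)
  then show ?case
    using letter_act_inv_letter[OF Cons.prems(1) word_act_in[OF Cons.prems]]
    by (simp add: inv_word_def)
qed (simp add: inv_word_def)

text \<open>Undoing \<open>v\<close> turns the comparison of two walks into a question about one
  word. In this way equations become relators, and walks ending at a newly labelled vertex are
  traced back to older ones.\<close>

lemma word_act_eq_iff:
  assumes "G \<in> sgraphs n" "x \<in> {1..n}" "y \<in> {1..n}"
  shows "word_act G w x = word_act G v y \<longleftrightarrow> word_act G (inv_word v @ w) x = y"
proof
  assume "word_act G w x = word_act G v y"
  then show "word_act G (inv_word v @ w) x = y" using word_act_inv_word assms by simp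
next
  assume "word_act G (inv_word v @ w) x = y"
  then show "word_act G w x = word_act G v y"
    using word_act_inv_word[OF assms(1) word_act_in[OF assms(1,2)], of "inv_word v" w] by auto
qed

section \<open>Free reduction and local statistics\<close>

primrec reduce :: "'s word \<Rightarrow> 's word" where
  "reduce [] = []"
| "reduce (a # w) = (case reduce w of [] \<Rightarrow> [a]
     | b # v \<Rightarrow> if b = inv_letter a then v else a # b # v)"

text \<open>The tail is reduced first, so only the new front letter can cancel, and what remains
  after a cancellation is a suffix of a reduced word.\<close>

lemma reduce_reduced: "reduce w \<in> reduced_words"
  by (induction w) (auto simp: reduced_words_def successively_Cons split: list.split)

lemma length_reduce_le: "length (reduce w) \<le> length w"
  by (induction w) (auto split: list.split)

lemma word_act_reduce:
  assumes "G \<in> sgraphs n" "x \<in> {1..n}"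
  shows "word_act G (reduce w) x = word_act G w x"
proof (induction w)
  case (Cons a w)
  show ?case
  proof (cases "reduce w")
    case (Cons b v)
    have "letter_act G a (letter_act G (inv_letter a) (word_act G v x)) = word_act G v x"
      using letter_act_inv_letter[OF assms(1) word_act_in[OF assms], of "inv_letter a"] by simp
    then show ?thesis using Cons Cons.IH by auto
  qed (use Cons.IH in auto)
qed simp

text \<open>\<open>stab\<close> records reduced words only; this makes it answer questions about
  arbitrary words.\<close>

lemma reduce_in_stab_iff:
  assumes "G \<in> sgraphs n" "x \<in> {1..n}"
  shows "reduce w \<in> stab G x \<longleftrightarrow> word_act G w x = x"
  using word_act_reduce[OF assms] by (simp add: stab_def reduce_reduced)

lemma pmf_stat:
  assumes "n \<ge> 1"
  shows "pmf (stat n G P) T = real (card {x \<in> {1..n}. stab G x \<inter> P = T}) / real n"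
proof -
  have "pmf (stat n G P) T = measure (pmf_of_set {1..n}) ((\<lambda>x. stab G x \<inter> P) -` {T})"
    by (simp add: stat_def pmf_map)
  also have "\<dots> = real (card ({1..n} \<inter> (\<lambda>x. stab G x \<inter> P) -` {T})) / real n"
    using assms by (subst measure_pmf_of_set) auto
  also have "{1..n} \<inter> (\<lambda>x. stab G x \<inter> P) -` {T} = {x \<in> {1..n}. stab G x \<inter> P = T}"
    by auto
  finally show ?thesis .
qed

section \<open>Relabelling\<close>

text \<open>This is the pullback along \<sigma>: the label \<open>x\<close> denotes the vertex
  \<open>\<sigma> x\<close>, so \<sigma> is an isomorphism from the relabelled graph onto
  \<open>G\<close>.\<close>

definition relabel :: "(nat \<Rightarrow> nat) \<Rightarrow> 's edges \<Rightarrow> 's edges" where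
  "relabel \<sigma> G = {(x, s, y). (\<sigma> x, s, \<sigma> y) \<in> G}"

lemma mem_relabel_iff: "(x, s, y) \<in> relabel \<sigma> G \<longleftrightarrow> (\<sigma> x, s, \<sigma> y) \<in> G"
  by (simp add: relabel_def)

lemma relabel_sgraphs:
  assumes "G \<in> sgraphs n" "\<sigma> permutes {1..n}"
  shows "relabel \<sigma> G \<in> sgraphs n"
proof -
  have sub: "G \<subseteq> {1..n} \<times> UNIV \<times> {1..n}" using assms(1) by (simp add: sgraphs_def)
  have in_iff: "\<sigma> x \<in> {1..n} \<longleftrightarrow> x \<in> {1..n}" for x by (rule permutes_in_image[OF assms(2)])
  have ex: "(\<exists>!y. Q (\<sigma> y)) \<longleftrightarrow> (\<exists>!y. Q y)" for Q
    using permutes_bij[OF assms(2)] by (metis bij_pointE)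
  have "relabel \<sigma> G \<subseteq> {1..n} \<times> UNIV \<times> {1..n}"
    unfolding relabel_def using sub in_iff by blast
  moreover have "(\<exists>!y. (x, s, y) \<in> relabel \<sigma> G) \<and> (\<exists>!y. (y, s, x) \<in> relabel \<sigma> G)"
    if "x \<in> {1..n}" for x s
    unfolding relabel_def using assms(1) that ex[of "\<lambda>y. (\<sigma> x, s, y) \<in> G"]
      ex[of "\<lambda>y. (y, s, \<sigma> x) \<in> G"] in_iff[of x] by (auto simp: sgraphs_def)
  ultimately show ?thesis by (simp add: sgraphs_def)
qed

lemma letter_act_relabel:
  assumes "G \<in> sgraphs n" "\<sigma> permutes {1..n}" "x \<in> {1..n}"
  shows "\<sigma> (letter_act (relabel \<sigma> G) a x) = letter_act G a (\<sigma> x)"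
proof -
  note R = relabel_sgraphs[OF assms(1,2)]
  have \<sigma>x: "\<sigma> x \<in> {1..n}" using assms permutes_in_image by metis
  show ?thesis
  proof (cases a)
    case (Gen s)
    have "(x, s, letter_act (relabel \<sigma> G) a x) \<in> relabel \<sigma> G"
      using sgraph_letter_act_Gen_eq_iff[OF R assms(3)] Gen by blast
    then show ?thesis
      using sgraph_letter_act_Gen_eq_iff[OF assms(1) \<sigma>x] Gen by (metis mem_relabel_iff)
  next
    case (Inv s)
    have "(letter_act (relabel \<sigma> G) a x, s, x) \<in> relabel \<sigma> G"
      using sgraph_letter_act_Inv_eq_iff[OF R assms(3)] Inv by blast
    then show ?thesis
      using sgraph_letter_act_Inv_eq_iff[OF assms(1) \<sigma>x] Inv by (metis mem_relabel_iff)
  qed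
qed

lemma word_act_relabel:
  assumes "G \<in> sgraphs n" "\<sigma> permutes {1..n}" "x \<in> {1..n}"
  shows "\<sigma> (word_act (relabel \<sigma> G) w x) = word_act G w (\<sigma> x)"
  using letter_act_relabel[OF assms(1,2)] word_act_in[OF relabel_sgraphs[OF assms(1,2)] assms(3)]
  by (induction w) auto

lemma stab_relabel:
  assumes "G \<in> sgraphs n" "\<sigma> permutes {1..n}" "x \<in> {1..n}"
  shows "stab (relabel \<sigma> G) x = stab G (\<sigma> x)"
  unfolding stab_def using word_act_relabel[OF assms] permutes_inj[OF assms(2)]
  by (metis (lifting) injD)

lemma relabel_relabel_inv:
  assumes "\<sigma> permutes A"
  shows "relabel \<sigma> (relabel (inv \<sigma>) G) = G"
  using permutes_inverses[OF assms] by (simp add: relabel_def)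

lemma relabel_GSol:
  assumes "G \<in> GSol E n" "\<sigma> permutes {1..n}"
  shows "relabel \<sigma> G \<in> GSol E n"
proof -
  have G: "G \<in> sgraphs n" using assms(1) by (simp add: GSol_def)
  have "word_act (relabel \<sigma> G) u x = word_act (relabel \<sigma> G) v x"
    if "(u, v) \<in> E" "x \<in> {1..n}" for u v x
  proof -
    have "\<sigma> x \<in> {1..n}" using that assms(2) permutes_in_image by metis
    then have "word_act G u (\<sigma> x) = word_act G v (\<sigma> x)"
      using assms(1) that(1) by (auto simp: GSol_def)
    then show ?thesis
      using word_act_relabel[OF G assms(2) that(2)] permutes_inj[OF assms(2)] by (metis injD)
  qed
  then show ?thesis using relabel_sgraphs[OF G assms(2)] by (auto simp: GSol_def)
qed

lemma hamming_dist_relabel: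
  assumes "G \<in> sgraphs n" "G' \<in> sgraphs n" "\<sigma> permutes {1..n}"
  shows "hamming_dist n (relabel \<sigma> G) (relabel \<sigma> G') = hamming_dist n G G'"
proof -
  have "card {x \<in> {1..n}. letter_act (relabel \<sigma> G) a x \<noteq> letter_act (relabel \<sigma> G') a x}
      = card {x \<in> {1..n}. letter_act G a x \<noteq> letter_act G' a x}" (is "card ?L = card ?R") for a
  proof -
    have iff: "letter_act (relabel \<sigma> G) a x \<noteq> letter_act (relabel \<sigma> G') a x \<longleftrightarrow>
        letter_act G a (\<sigma> x) \<noteq> letter_act G' a (\<sigma> x)" if "x \<in> {1..n}" for x
      using letter_act_relabel[OF assms(1,3) that] letter_act_relabel[OF assms(2,3) that]
        permutes_inj[OF assms(3)] by (metis injD)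
    have "\<sigma> ` ?L = {y \<in> \<sigma> ` {1..n}. letter_act G a y \<noteq> letter_act G' a y}"
      using iff by (auto simp del: atLeastAtMost_iff)
    then have "\<sigma> ` ?L = ?R" unfolding permutes_image[OF assms(3)] .
    with card_image[OF permutes_inj_on[OF assms(3)], of ?L] show ?thesis by argo
  qed
  then show ?thesis by (simp only: hamming_dist_def)
qed

text \<open>Every solution is the relabelling of a solution, by \<open>relabel_relabel_inv\<close>,
  and relabelling both graphs preserves their distance.\<close>

lemma relabel_GSol_far:
  assumes "G \<in> GSol_far E \<epsilon> n" "\<sigma> permutes {1..n}"
  shows "relabel \<sigma> G \<in> GSol_far E \<epsilon> n"
proof -
  have G: "G \<in> sgraphs n" using assms(1) by (simp add: GSol_far_def)
  have "hamming_dist n (relabel \<sigma> G) G' \<ge> \<epsilon>" if "G' \<in> GSol E n" for G'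
  proof -
    have K: "relabel (inv \<sigma>) G' \<in> GSol E n"
      by (rule relabel_GSol[OF that permutes_inv[OF assms(2)]])
    then have "hamming_dist n (relabel \<sigma> G) (relabel \<sigma> (relabel (inv \<sigma>) G')) \<ge> \<epsilon>"
      using hamming_dist_relabel[OF G _ assms(2)] assms(1) by (simp add: GSol_far_def GSol_def)
    then show ?thesis by (simp add: relabel_relabel_inv[OF assms(2)])
  qed
  then show ?thesis using relabel_sgraphs[OF G assms(2)] by (simp add: GSol_far_def)
qed

lemma GSol_far_not_GSol:
  assumes "\<epsilon> > 0" "G \<in> GSol_far E \<epsilon> n"
  shows "G \<notin> GSol E n"
  using assms by (force simp: GSol_far_def hamming_dist_def)

section \<open>Permutations extending a partial injection\<close>

text \<open>The relabellings that remain possible once the values on \<open>D\<close> have been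
  revealed.\<close>

definition extensions :: "'a set \<Rightarrow> 'a set \<Rightarrow> ('a \<Rightarrow> 'a) \<Rightarrow> ('a \<Rightarrow> 'a) set" where
  "extensions A D f = {\<sigma>. \<sigma> permutes A \<and> (\<forall>d\<in>D. \<sigma> d = f d)}"

lemma finite_extensions: "finite A \<Longrightarrow> finite (extensions A D f)"
  by (rule finite_subset[OF _ finite_permutations[of A]]) (auto simp: extensions_def)

lemma extensions_mono: "x \<notin> D \<Longrightarrow> extensions A (insert x D) (f(x := u)) \<subseteq> extensions A D f"
  by (auto simp: extensions_def)

text \<open>Conditioning on which vertex the label \<open>x\<close> denotes. Injectivity excludes
  the values already taken on \<open>D\<close>.\<close>

lemma sum_extensions_value:
  assumes "finite A" "D \<subseteq> A" "x \<in> A - D"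
  shows "sum h (extensions A D f) =
    (\<Sum>u\<in>A - f ` D. sum h (extensions A (insert x D) (f(x := u))))"
proof -
  have "extensions A (insert x D) (f(x := u)) = {\<sigma> \<in> extensions A D f. \<sigma> x = u}" for u
    using assms by (auto simp: extensions_def)
  moreover have "(\<lambda>\<sigma>. \<sigma> x) ` extensions A D f \<subseteq> A - f ` D"
  proof (clarsimp simp: extensions_def, safe)
    fix \<sigma> assume \<sigma>: "\<sigma> permutes A" "\<forall>d\<in>D. \<sigma> d = f d"
    show "\<sigma> x \<in> A" using assms \<sigma>(1) by (simp add: permutes_in_image)
    fix d assume d: "d \<in> D" "\<sigma> x = f d"
    then have "\<sigma> x = \<sigma> d" using \<sigma> by simp
    then have "x = d" using permutes_inj[OF \<sigma>(1)] by (metis injD)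
    then show False using assms d by simp
  qed
  ultimately show ?thesis
    using sum.group[OF finite_extensions[OF assms(1)], of "A - f ` D" "\<lambda>\<sigma>. \<sigma> x" D f h] assms
    by simp
qed

text \<open>The dual split, by the label of a given vertex \<open>y\<close>: it serves when a query
  leads to a vertex whose label is still unknown.\<close>

lemma sum_extensions_preimage:
  assumes "finite A" "D \<subseteq> A" "y \<in> A - f ` D"
  shows "sum h (extensions A D f) =
    (\<Sum>z\<in>A - D. sum h (extensions A (insert z D) (f(z := y))))"
proof -
  have inv_eq: "inv \<sigma> y = z \<longleftrightarrow> \<sigma> z = y" if "\<sigma> permutes A" for \<sigma> z
    using permutes_inverses[OF that] by metis
  have "extensions A (insert z D) (f(z := y)) = {\<sigma> \<in> extensions A D f. inv \<sigma> y = z}"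
    if "z \<in> A - D" for z
    using that inv_eq by (auto simp: extensions_def)
  moreover have "(\<lambda>\<sigma>. inv \<sigma> y) ` extensions A D f \<subseteq> A - D"
  proof (clarsimp simp: extensions_def, safe)
    fix \<sigma> assume \<sigma>: "\<sigma> permutes A" "\<forall>d\<in>D. \<sigma> d = f d"
    show "inv \<sigma> y \<in> A" using assms permutes_inv[OF \<sigma>(1)] by (simp add: permutes_in_image)
    assume "inv \<sigma> y \<in> D"
    then have "f (inv \<sigma> y) = y" using \<sigma> permutes_inverses[OF \<sigma>(1)] by metis
    then show False using assms(3) imageI[OF \<open>inv \<sigma> y \<in> D\<close>, of f] by simp
  qed
  ultimately show ?thesis
    using sum.group[OF finite_extensions[OF assms(1)], of "A - D" "\<lambda>\<sigma>. inv \<sigma> y" D f h] assms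
    by simp
qed

text \<open>Induction on the number of points left: a further point has as many possible values as
  there are points left.\<close>

lemma card_extensions:
  assumes "finite A" "D \<subseteq> A" "inj_on f D" "f ` D \<subseteq> A"
  shows "card (extensions A D f) = fact (card A - card D)"
  using assms
proof (induction "card A - card D" arbitrary: D f)
  case 0
  then have "D = A" by (simp add: card_subset_eq card_mono dual_order.antisym)
  \<comment> \<open>With all of \<open>A\<close> prescribed, the only extension is \<open>f\<close>
    on \<open>A\<close> and the identity elsewhere.\<close>
  define \<sigma> where "\<sigma> x = (if x \<in> A then f x else x)" for x
  have "bij_betw \<sigma> A A"
    using 0 \<open>D = A\<close> endo_inj_surj[of A f] by (simp add: \<sigma>_def bij_betw_def inj_on_def)
  then have "\<sigma> permutes A" by (rule bij_imp_permutes) (simp add: \<sigma>_def)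
  then have "extensions A D f = {\<sigma>}"
    using \<open>D = A\<close> permutes_not_in by (fastforce simp: extensions_def \<sigma>_def)
  then show ?case using 0 by simp
next
  case (Suc k)
  have "D \<noteq> A" using Suc.hyps(2) by auto
  then obtain x where x: "x \<in> A - D" using Suc.prems by blast
  have fin: "finite D" using Suc finite_subset by blast
  have "card (extensions A D f) = (\<Sum>u\<in>A - f ` D. card (extensions A (insert x D) (f(x := u))))"
    using sum_extensions_value[of A D x "\<lambda>_. 1 :: nat" f] Suc.prems x by simp
  also have "\<dots> = (\<Sum>u\<in>A - f ` D. fact k)"
  proof (rule sum.cong)
    fix u assume u: "u \<in> A - f ` D"
    have "k = card A - card (insert x D)" using Suc.hyps(2) x fin by simp
    moreover have "inj_on (f(x := u)) (insert x D)" "(f(x := u)) ` insert x D \<subseteq> A"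
      using Suc.prems u x by (auto simp: inj_on_def)
    ultimately show "card (extensions A (insert x D) (f(x := u))) = fact k"
      using Suc.hyps(1)[of "insert x D" "f(x := u)"] Suc.prems x by simp
  qed simp
  also have "\<dots> = Suc k * fact k"
    using Suc fin by (simp add: card_Diff_subset card_image)
  finally show ?case by (simp add: Suc.hyps(2)[symmetric] del: of_nat_Suc)
qed

section \<open>Testers on randomly relabelled graphs\<close>

text \<open>The invariant of the coupling. For \<open>d = d'\<close> it compares closed walks at
  labelled vertices, for \<open>d \<noteq> d'\<close> the walks joining two of them.\<close>

definition locally_alike ::
  "'s edges \<Rightarrow> 's edges \<Rightarrow> nat \<Rightarrow> nat set \<Rightarrow> (nat \<Rightarrow> nat) \<Rightarrow> (nat \<Rightarrow> nat) \<Rightarrow> bool" where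
  "locally_alike G H r D f g \<longleftrightarrow> (\<forall>d\<in>D. \<forall>d'\<in>D. \<forall>w. length w \<le> r \<longrightarrow>
     (word_act G w (f d) = f d' \<longleftrightarrow> word_act H w (g d) = g d'))"

lemma locally_alike_mono: "locally_alike G H r D f g \<Longrightarrow> r' \<le> r \<Longrightarrow> locally_alike G H r' D f g"
  by (simp add: locally_alike_def)

text \<open>A walk starting or ending at the new vertex is a walk between labelled vertices with one
  more letter at that end. Both ends may be new, hence the loss of 2 in the radius.\<close>

lemma locally_alike_neighbour:
  fixes G H :: "'s edges"
  assumes G: "G \<in> sgraphs n" and H: "H \<in> sgraphs n"
    and fD: "f ` D \<subseteq> {1..n}" and gD: "g ` D \<subseteq> {1..n}"
    and alike: "locally_alike G H (r + 2) D f g"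
    and x: "x \<in> D" and z: "z \<notin> D"
  shows "locally_alike G H r (insert z D)
    (f(z := letter_act G a (f x))) (g(z := letter_act H a (g x)))" (is "locally_alike G H r _ ?f ?g")
proof -
  \<comment> \<open>Each vertex is written as the end of a path of length at most 1 from an already
    labelled vertex, which treats old and new vertices uniformly.\<close>
  define base where "base d = (if d = z then x else d)" for d
  define path where "path d = (if d = z then [a] else [])" for d :: nat
  have base: "base d \<in> D" if "d \<in> insert z D" for d
    using that x by (auto simp: base_def)
  have f: "?f d = word_act G (path d) (f (base d))" for d
    by (simp add: base_def path_def)
  have g: "?g d = word_act H (path d) (g (base d))" for d
    by (simp add: base_def path_def)
  show ?thesis
    unfolding locally_alike_def
  proof (intro ballI allI impI)
    fix d d' and w :: "'s word" assume dd: "d \<in> insert z D" "d' \<in> insert z D" and w: "length w \<le> r"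
    let ?v = "inv_word (path d') @ w @ path d"
    have "length ?v \<le> r + 2" using w by (simp add: path_def)
    then have "word_act G ?v (f (base d)) = f (base d') \<longleftrightarrow> word_act H ?v (g (base d)) = g (base d')"
      using alike base[OF dd(1)] base[OF dd(2)] unfolding locally_alike_def by blast
    moreover have "word_act G w (?f d) = ?f d' \<longleftrightarrow> word_act G ?v (f (base d)) = f (base d')"
      using word_act_eq_iff[OF G, of "f (base d)" "f (base d')" "w @ path d" "path d'"]
        subsetD[OF fD imageI[OF base[OF dd(1)]]] subsetD[OF fD imageI[OF base[OF dd(2)]]]
      unfolding f by (simp only: word_act_append)
    moreover have "word_act H w (?g d) = ?g d' \<longleftrightarrow> word_act H ?v (g (base d)) = g (base d')"
      using word_act_eq_iff[OF H, of "g (base d)" "g (base d')" "w @ path d" "path d'"]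
        subsetD[OF gD imageI[OF base[OF dd(1)]]] subsetD[OF gD imageI[OF base[OF dd(2)]]]
      unfolding g by (simp only: word_act_append)
    ultimately show "word_act G w (?f d) = ?f d' \<longleftrightarrow> word_act H w (?g d) = ?g d'" by blast
  qed
qed

text \<open>A vertex out of reach of all labelled vertices is joined to them by no short walk in
  either graph, so only its own closed walks have to agree.\<close>

lemma locally_alike_new_root:
  assumes G: "G \<in> sgraphs n" and H: "H \<in> sgraphs n"
    and fD: "f ` D \<subseteq> {1..n}" and gD: "g ` D \<subseteq> {1..n}"
    and alike: "locally_alike G H r D f g"
    and x: "x \<notin> D" and u: "u \<in> {1..n}"
    and same: "\<And>w. length w \<le> r \<Longrightarrow> word_act G w u = u \<longleftrightarrow> word_act H w u = u"
    and apart: "\<And>w d. length w \<le> r \<Longrightarrow> d \<in> D \<Longrightarrow> word_act G w (f d) \<noteq> u \<and> word_act H w (g d) \<noteq> u"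
  shows "locally_alike G H r (insert x D) (f(x := u)) (g(x := u))"
proof -
  \<comment> \<open>A walk from \<open>u\<close> to a labelled vertex, read backwards, would
    contradict \<open>apart\<close>.\<close>
  have "word_act G w u \<noteq> f d \<and> word_act H w u \<noteq> g d" if "length w \<le> r" "d \<in> D" for w d
  proof -
    have "f d \<in> {1..n}" "g d \<in> {1..n}" using fD gD that by auto
    then show ?thesis
      using apart[of "inv_word w" d] that word_act_inv_word[OF G u, of w]
        word_act_inv_word[OF H u, of w] by auto
  qed
  then show ?thesis
    using alike same apart x by (auto simp: locally_alike_def)
qed

lemma inj_on_fun_upd_insert:
  "inj_on f D \<Longrightarrow> y \<notin> f ` D \<Longrightarrow> inj_on (f(z := y)) (insert z D)"
  by (auto simp: inj_on_def)

lemma fun_upd_insert_image_subset: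
  "f ` D \<subseteq> A \<Longrightarrow> y \<in> A \<Longrightarrow> (f(z := y)) ` insert z D \<subseteq> A"
  by auto

text \<open>Up to the factor \<open>fact (n - card D)\<close>, this is the probability of the answer \<open>b\<close> on a random
  relabelling of \<open>G\<close>, given that the relabelling extends \<open>f\<close>.\<close>

definition accept_sum :: "nat \<Rightarrow> 's edges \<Rightarrow> ('s, 'a) algo \<Rightarrow> 'a \<Rightarrow> nat set \<Rightarrow> (nat \<Rightarrow> nat) \<Rightarrow> real" where
  "accept_sum n G A b D f = (\<Sum>\<sigma>\<in>extensions {1..n} D f. pmf (run (relabel \<sigma> G) A) b)"

lemma accept_sum_bounds:
  assumes "D \<subseteq> {1..n}" "inj_on f D" "f ` D \<subseteq> {1..n}"
  shows "0 \<le> accept_sum n G A b D f" "accept_sum n G A b D f \<le> fact (n - card D)"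
proof -
  show "0 \<le> accept_sum n G A b D f" by (simp add: accept_sum_def sum_nonneg)
  have "accept_sum n G A b D f \<le> real (card (extensions {1..n} D f)) * 1"
    unfolding accept_sum_def by (intro sum_bounded_above) (simp add: pmf_le_1)
  also have "\<dots> = fact (n - card D)"
    using card_extensions[OF _ assms] by simp
  finally show "accept_sum n G A b D f \<le> fact (n - card D)" .
qed

lemma accept_sum_value:
  assumes "D \<subseteq> {1..n}" "x \<in> {1..n} - D"
  shows "accept_sum n G A b D f =
    (\<Sum>u\<in>{1..n} - f ` D. accept_sum n G A b (insert x D) (f(x := u)))"
  unfolding accept_sum_def by (rule sum_extensions_value) (use assms in auto)

lemma accept_sum_preimage:
  assumes "D \<subseteq> {1..n}" "y \<in> {1..n} - f ` D"
  shows "accept_sum n G A b D f =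
    (\<Sum>z\<in>{1..n} - D. accept_sum n G A b (insert z D) (f(z := y)))"
  unfolding accept_sum_def by (rule sum_extensions_preimage) (use assms in auto)

text \<open>Once both ends of an edge are revealed, the answer is the same for every relabelling
  that is still possible.\<close>

lemma letter_act_relabel_extensions:
  assumes "G \<in> sgraphs n" "\<sigma> \<in> extensions {1..n} D f" "D \<subseteq> {1..n}" "x \<in> D" "z \<in> D"
    "letter_act G a (f x) = f z"
  shows "letter_act (relabel \<sigma> G) a x = z"
proof -
  have p: "\<sigma> permutes {1..n}" and "\<sigma> x = f x" "\<sigma> z = f z"
    using assms by (auto simp: extensions_def)
  then have "\<sigma> (letter_act (relabel \<sigma> G) a x) = \<sigma> z"
    using letter_act_relabel[OF assms(1) p, of x a] assms by auto
  then show ?thesis using permutes_inj[OF p] by (metis injD)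
qed

text \<open>The answer to a query at a labelled vertex is either an already used label, the same one for
  both graphs, or a label which is uniformly distributed among the unused ones.\<close>

lemma accept_sum_query_labelled:
  assumes G: "G \<in> sgraphs n" and H: "H \<in> sgraphs n"
    and D: "D \<subseteq> {1..n}" and f: "inj_on f D" "f ` D \<subseteq> {1..n}" and g: "inj_on g D" "g ` D \<subseteq> {1..n}"
    and alike: "locally_alike G H (2 * Suc q) D f g" and x: "x \<in> D"
    and IH: "\<And>z D' f' g'. \<lbrakk>D' \<subseteq> {1..n}; inj_on f' D'; f' ` D' \<subseteq> {1..n}; inj_on g' D'; g' ` D' \<subseteq> {1..n};
       card D' \<le> Suc (card D); locally_alike G H (2 * q) D' f' g';
       extensions {1..n} D' f' \<subseteq> extensions {1..n} D f;
       \<And>\<sigma>. \<sigma> \<in> extensions {1..n} D' f' \<Longrightarrow> letter_act (relabel \<sigma> G) a x = z\<rbrakk> \<Longrightarrow>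
       \<bar>accept_sum n G (c z) b D' f' - accept_sum n H (c z) b D' g'\<bar> \<le> e * fact (n - card D')"
  shows "\<bar>accept_sum n G (Query x a c) b D f - accept_sum n H (Query x a c) b D g\<bar> \<le> e * fact (n - card D)"
proof -
  let ?A = "{1..n}" and ?y = "letter_act G a (f x)" and ?y' = "letter_act H a (g x)"
  have fin: "finite D" using D finite_subset by blast
  have y: "?y \<in> ?A" "?y' \<in> ?A" using letter_act_in[OF G] letter_act_in[OF H] f g x by blast+
  \<comment> \<open>With the answer \<open>z\<close> known, the query can be skipped and the
    continuation \<open>c z\<close> compared instead.\<close>
  have step: "accept_sum n K (Query x a c) b D' h = accept_sum n K (c z) b D' h"
    if "K \<in> sgraphs n" "D' \<subseteq> {1..n}" "x \<in> D'" "z \<in> D'" "letter_act K a (h x) = h z" for K D' h z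
    unfolding accept_sum_def
    using letter_act_relabel_extensions[OF that(1) _ that(2-5)] by (intro sum.cong) auto
  \<comment> \<open>The one-letter word \<open>[a]\<close> shows that the neighbour is labelled in
    both graphs or in neither, and then with the same label.\<close>
  have alike1: "?y = f d \<longleftrightarrow> ?y' = g d" if "d \<in> D" for d
  proof -
    have "word_act G [a] (f x) = f d \<longleftrightarrow> word_act H [a] (g x) = g d"
      using alike x that unfolding locally_alike_def by (simp del: word_act_Cons)
    then show ?thesis by simp
  qed
  show ?thesis
  proof (cases "?y \<in> f ` D")
    case True
    then obtain z where z: "z \<in> D" "?y = f z" by auto
    then have z': "?y' = g z" using alike1 by blast
    have "\<bar>accept_sum n G (c z) b D f - accept_sum n H (c z) b D g\<bar> \<le> e * fact (n - card D)"
      by (rule IH)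
        (use D f g locally_alike_mono[OF alike] letter_act_relabel_extensions[OF G _ D x z(1) z(2)] in auto)
    then show ?thesis using step[OF G D x z] step[OF H D x z(1) z'] by simp
  next
    case False
    then have y'_ran: "?y' \<notin> g ` D" using alike1 by auto
    let ?f = "\<lambda>z. f(z := ?y)" and ?g = "\<lambda>z. g(z := ?y')"
    \<comment> \<open>The neighbour receives the same fresh label \<open>z\<close> in both graphs.
      The radius falls by 2, just as the hypothesis for \<open>q\<close> instead of
      \<open>Suc q\<close> queries allows.\<close>
    have bound: "\<bar>accept_sum n G (Query x a c) b (insert z D) (?f z)
        - accept_sum n H (Query x a c) b (insert z D) (?g z)\<bar> \<le> e * fact (n - Suc (card D))"
      if z: "z \<in> ?A - D" for z
    proof -
      have zx: "z \<noteq> x" using z x by auto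
      have D': "insert z D \<subseteq> {1..n}" using z D by auto
      have sub: "extensions {1..n} (insert z D) (?f z) \<subseteq> extensions {1..n} D f"
        by (rule extensions_mono) (use z in auto)
      have "\<bar>accept_sum n G (c z) b (insert z D) (?f z) - accept_sum n H (c z) b (insert z D) (?g z)\<bar>
          \<le> e * fact (n - card (insert z D))"
      proof (rule IH[OF D'])
        show "inj_on (?f z) (insert z D)" "inj_on (?g z) (insert z D)"
          by (rule inj_on_fun_upd_insert[OF f(1) False], rule inj_on_fun_upd_insert[OF g(1) y'_ran])
        show "?f z ` insert z D \<subseteq> {1..n}" "?g z ` insert z D \<subseteq> {1..n}"
          by (rule fun_upd_insert_image_subset[OF f(2) y(1)],
              rule fun_upd_insert_image_subset[OF g(2) y(2)])
        show "locally_alike G H (2 * q) (insert z D) (?f z) (?g z)"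
          using locally_alike_neighbour[OF G H f(2) g(2) _ x, of "2 * q" z a] alike z by simp
        show "letter_act (relabel \<sigma> G) a x = z" if "\<sigma> \<in> extensions {1..n} (insert z D) (?f z)" for \<sigma>
          using letter_act_relabel_extensions[OF G that D', of x z a] x zx by simp
      qed (use sub z fin in auto)
      then show ?thesis
        using step[OF G D', of z "?f z"] step[OF H D', of z "?g z"] x zx z fin by simp
    qed
    have "\<bar>accept_sum n G (Query x a c) b D f - accept_sum n H (Query x a c) b D g\<bar>
        = \<bar>\<Sum>z\<in>?A - D. accept_sum n G (Query x a c) b (insert z D) (?f z)
        - accept_sum n H (Query x a c) b (insert z D) (?g z)\<bar>"
      unfolding sum_subtractf
      by (simp only: accept_sum_preimage[OF D DiffI[OF y(1) False]]
          accept_sum_preimage[OF D DiffI[OF y(2) y'_ran]])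
    also have "\<dots> \<le> (\<Sum>z\<in>?A - D. e * fact (n - Suc (card D)))"
      by (rule order_trans[OF sum_abs sum_mono]) (rule bound)
    also have "\<dots> = e * (real (n - card D) * fact (n - Suc (card D)))"
      using D fin by (simp add: card_Diff_subset)
    also have "\<dots> = e * fact (n - card D)"
    proof -
      have "D \<noteq> ?A" using False y f D by (metis card_image card_subset_eq finite_atLeastAtMost)
      then have "card D < n" using psubset_card_mono[of ?A D] D by auto
      then show ?thesis
        by (simp add: fact_reduce[of "n - card D"])
    qed
    finally show ?thesis .
  qed
qed

lemma accept_sum_new_root:
  assumes D: "D \<subseteq> {1..n}" and f: "inj_on f D" "f ` D \<subseteq> {1..n}" and g: "inj_on g D" "g ` D \<subseteq> {1..n}"
    and x: "x \<in> {1..n} - D" and e: "e \<ge> 0"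
    and bad: "finite Bad" "f ` D \<subseteq> Bad" "g ` D \<subseteq> Bad" "Bad \<subseteq> {1..n}"
    and good: "\<And>u. u \<in> {1..n} - Bad \<Longrightarrow>
       \<bar>accept_sum n G A b (insert x D) (f(x := u)) - accept_sum n H A b (insert x D) (g(x := u))\<bar>
         \<le> e * fact (n - Suc (card D))"
    and \<beta>: "real (card Bad) \<le> \<beta> * real (n - card D)"
  shows "\<bar>accept_sum n G A b D f - accept_sum n H A b D g\<bar> \<le> (e + \<beta>) * fact (n - card D)"
proof -
  let ?A = "{1..n}"
  have fin: "finite D" using D finite_subset by blast
  have "D \<subset> ?A" using D x by auto
  then have "card D < n" using psubset_card_mono[of ?A D] by auto
  then have fact: "fact (n - card D) = real (n - card D) * fact (n - Suc (card D))"
    by (simp add: fact_reduce[of "n - card D"])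
  define F where "F u = accept_sum n G A b (insert x D) (f(x := u))" for u
  define K where "K u = accept_sum n H A b (insert x D) (g(x := u))" for u
  have bounds: "0 \<le> accept_sum n J A b (insert x D) (h(x := u))"
     "accept_sum n J A b (insert x D) (h(x := u)) \<le> fact (n - Suc (card D))"
    if "inj_on h D" "h ` D \<subseteq> ?A" "u \<in> ?A - h ` D" for J h u
  proof -
    have "insert x D \<subseteq> ?A" "inj_on (h(x := u)) (insert x D)" "(h(x := u)) ` insert x D \<subseteq> ?A"
      using that x D inj_on_fun_upd_insert[OF that(1), of u x]
        fun_upd_insert_image_subset[OF that(2), of u x] by auto
    from accept_sum_bounds[OF this, of J A b]
    show "0 \<le> accept_sum n J A b (insert x D) (h(x := u))"
      "accept_sum n J A b (insert x D) (h(x := u)) \<le> fact (n - Suc (card D))"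
      using x fin by auto
  qed
  have split: "accept_sum n J A b D h = (\<Sum>u\<in>?A - Bad. accept_sum n J A b (insert x D) (h(x := u)))
      + (\<Sum>u\<in>Bad - h ` D. accept_sum n J A b (insert x D) (h(x := u)))"
    if "h ` D \<subseteq> Bad" for J h
  proof -
    have "?A - h ` D = (?A - Bad) \<union> (Bad - h ` D)" using that bad by auto
    then have "(\<Sum>u\<in>?A - h ` D. accept_sum n J A b (insert x D) (h(x := u))) =
      (\<Sum>u\<in>?A - Bad. accept_sum n J A b (insert x D) (h(x := u)))
      + (\<Sum>u\<in>Bad - h ` D. accept_sum n J A b (insert x D) (h(x := u)))"
      by (simp only:) (rule sum.union_disjoint, use bad in auto)
    then show ?thesis by (simp only: accept_sum_value[OF D x])
  qed
  \<comment> \<open>The bad parts of both sums lie between 0 and the same bound, so their difference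
    costs \<beta> only once.\<close>
  have rest: "0 \<le> (\<Sum>u\<in>Bad - h ` D. accept_sum n J A b (insert x D) (h(x := u)))"
    "(\<Sum>u\<in>Bad - h ` D. accept_sum n J A b (insert x D) (h(x := u))) \<le> \<beta> * fact (n - card D)"
    if h: "inj_on h D" "h ` D \<subseteq> ?A" for J h
  proof -
    have u: "u \<in> ?A - h ` D" if "u \<in> Bad - h ` D" for u using that bad by auto
    show "0 \<le> (\<Sum>u\<in>Bad - h ` D. accept_sum n J A b (insert x D) (h(x := u)))"
      using bounds(1)[OF h u] by (rule sum_nonneg)
    have "(\<Sum>u\<in>Bad - h ` D. accept_sum n J A b (insert x D) (h(x := u)))
        \<le> real (card (Bad - h ` D)) * fact (n - Suc (card D))"
      by (rule sum_bounded_above) (rule bounds(2)[OF h u])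
    also have "\<dots> \<le> real (card Bad) * fact (n - Suc (card D))"
      using bad by (intro mult_right_mono) (auto intro: card_mono)
    also have "\<dots> \<le> \<beta> * real (n - card D) * fact (n - Suc (card D))"
      using \<beta> by (intro mult_right_mono) auto
    finally show "(\<Sum>u\<in>Bad - h ` D. accept_sum n J A b (insert x D) (h(x := u))) \<le> \<beta> * fact (n - card D)"
      by (simp add: fact mult.assoc)
  qed
  have "\<bar>(\<Sum>u\<in>?A - Bad. F u) - (\<Sum>u\<in>?A - Bad. K u)\<bar> \<le> (\<Sum>u\<in>?A - Bad. e * fact (n - Suc (card D)))"
    unfolding sum_subtractf[symmetric] F_def K_def
    by (rule order_trans[OF sum_abs sum_mono]) (rule good)
  also have "\<dots> = real (card (?A - Bad)) * (e * fact (n - Suc (card D)))" by simp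
  also have "\<dots> \<le> real (n - card D) * (e * fact (n - Suc (card D)))"
  proof (rule mult_right_mono)
    \<comment> \<open>All used vertices count as bad, so there are at most \<open>n - card D\<close>
      good ones.\<close>
    have "card D \<le> card Bad" using bad f card_mono card_image by metis
    then show "real (card (?A - Bad)) \<le> real (n - card D)" using bad by (simp add: card_Diff_subset)
  qed (use e in simp)
  also have "\<dots> = e * fact (n - card D)" by (simp add: fact)
  finally show ?thesis
    using split[OF bad(2), of G] split[OF bad(3), of H] rest[OF f, of G] rest[OF g, of H]
    unfolding F_def K_def distrib_right by linarith
qed

lemma finite_words_length_le: "finite {w :: ('s::finite) word. length w \<le> N}"
proof -
  have "a \<in> range Gen \<union> range Inv" for a :: "'s letter"
    by (cases a) auto
  then have "(UNIV :: 's letter set) \<subseteq> range Gen \<union> range Inv" by blast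
  then have "finite (UNIV :: 's letter set)" by (rule finite_subset) simp
  then show ?thesis using finite_lists_length_le[of "UNIV :: 's letter set" N] by simp
qed

lemma accept_sum_Sample:
  "accept_sum n G (Sample p c) b D f = (\<integral>r. accept_sum n G (c r) b D f \<partial>measure_pmf p)"
  unfolding accept_sum_def
  by (subst Bochner_Integration.integral_sum)
    (auto simp: pmf_bind pmf_le_1 intro!: measure_pmf.integrable_const_bound[where B = 1])

lemma accept_sum_close:
  fixes A :: "('s::finite, 'a) algo"
  assumes G: "G \<in> sgraphs n" and H: "H \<in> sgraphs n" and \<beta>: "0 \<le> \<beta>"
    and B: "\<And>u w. u \<in> {1..n} - B \<Longrightarrow> length w \<le> m \<Longrightarrow> word_act G w u = u \<longleftrightarrow> word_act H w u = u"
    and B_sub: "B \<subseteq> {1..n}"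
    and \<beta>_bound: "real (card B) + 2 * real m * real (card {w :: 's word. length w \<le> m}) \<le> \<beta> * real (n - m)"
    and D: "D \<subseteq> {1..n}" and f: "inj_on f D" "f ` D \<subseteq> {1..n}" and g: "inj_on g D" "g ` D \<subseteq> {1..n}"
    and m: "card D + 2 * q \<le> m"
    and alike: "locally_alike G H (2 * q) D f g"
    and queries: "\<And>\<sigma>. \<sigma> \<in> extensions {1..n} D f \<Longrightarrow> queries_at_most n (relabel \<sigma> G) q A"
  shows "\<bar>accept_sum n G A b D f - accept_sum n H A b D g\<bar> \<le> \<beta> * real q * fact (n - card D)"
  using D f g m alike queries
proof (induction A arbitrary: q D f g)
  case (Return a)
  \<comment> \<open>The answer is fixed, and equally many relabellings extend \<open>f\<close> and
    \<open>g\<close>.\<close>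
  then have "accept_sum n G (Return a) b D f = accept_sum n H (Return a) b D g"
    by (simp add: accept_sum_def card_extensions)
  then show ?case using \<beta> by simp
next
  case (Query x a c)
  note D = Query.prems(1) and f = Query.prems(2,3) and g = Query.prems(4,5)
    and m = Query.prems(6) and alike = Query.prems(7)
  have fin: "finite D" using D finite_subset by blast
  \<comment> \<open>Some relabelling extends \<open>f\<close>; its query bound shows that
    \<open>x\<close> is a vertex and that a query is left.\<close>
  have "card (extensions {1..n} D f) > 0"
    unfolding card_extensions[OF finite_atLeastAtMost D f] by simp
  then obtain \<sigma> where "\<sigma> \<in> extensions {1..n} D f" by (metis card_gt_0_iff ex_in_conv)
  from Query.prems(8)[OF this] have x: "x \<in> {1..n}" and "q > 0" by auto
  then obtain q' where q: "q = Suc q'" by (cases q) auto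
  \<comment> \<open>Stated for a general \<open>D'\<close>, as it is applied to \<open>D\<close>
    itself when \<open>x\<close> is labelled and to \<open>insert x D\<close> after a fresh
    \<open>x\<close> has been placed.\<close>
  have labelled: "\<bar>accept_sum n G (Query x a c) b D' f' - accept_sum n H (Query x a c) b D' g'\<bar>
      \<le> \<beta> * real q' * fact (n - card D')"
    if D': "D' \<subseteq> {1..n}" "card D' \<le> Suc (card D)" "x \<in> D'"
      and f': "inj_on f' D'" "f' ` D' \<subseteq> {1..n}" and g': "inj_on g' D'" "g' ` D' \<subseteq> {1..n}"
      and alike': "locally_alike G H (2 * Suc q') D' f' g'"
      and ext: "extensions {1..n} D' f' \<subseteq> extensions {1..n} D f" for D' f' g'
  proof (rule accept_sum_query_labelled[OF G H D'(1) f' g' alike' D'(3)])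
    fix z D'' f'' g''
    assume *: "D'' \<subseteq> {1..n}" "inj_on f'' D''" "f'' ` D'' \<subseteq> {1..n}" "inj_on g'' D''"
      "g'' ` D'' \<subseteq> {1..n}" and card: "card D'' \<le> Suc (card D')"
      and alike'': "locally_alike G H (2 * q') D'' f'' g''"
      and ext': "extensions {1..n} D'' f'' \<subseteq> extensions {1..n} D' f'"
      and ans: "\<And>\<sigma>. \<sigma> \<in> extensions {1..n} D'' f'' \<Longrightarrow> letter_act (relabel \<sigma> G) a x = z"
    show "\<bar>accept_sum n G (c z) b D'' f'' - accept_sum n H (c z) b D'' g''\<bar>
      \<le> \<beta> * real q' * fact (n - card D'')"
    proof (rule Query.IH[OF rangeI * _ alike''])
      show "card D'' + 2 * q' \<le> m" using card D' m q by simp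
      show "queries_at_most n (relabel \<sigma> G) q' (c z)" if "\<sigma> \<in> extensions {1..n} D'' f''" for \<sigma>
        using Query.prems(8)[of \<sigma>] that ext ext' ans[OF that] q by auto
    qed
  qed
  show ?case
  proof (cases "x \<in> D")
    case True
    have "\<bar>accept_sum n G (Query x a c) b D f - accept_sum n H (Query x a c) b D g\<bar>
      \<le> \<beta> * real q' * fact (n - card D)"
      by (rule labelled) (use True D f g alike q in auto)
    also have "\<dots> \<le> \<beta> * real q * fact (n - card D)"
      using \<beta> q by (intro mult_right_mono mult_left_mono) auto
    finally show ?thesis .
  next
    case False
    define W where "W = {w :: 's word. length w \<le> m}"
    have finW: "finite W" unfolding W_def by (rule finite_words_length_le)
    \<comment> \<open>The balls of radius \<open>m\<close> around the labelled vertices in both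
      graphs. The empty word puts the labelled vertices themselves into \<open>near\<close>.\<close>
    define near where "near = (\<lambda>(d, w). word_act G w (f d)) ` (D \<times> W)
      \<union> (\<lambda>(d, w). word_act H w (g d)) ` (D \<times> W)"
    have card_near: "card near \<le> 2 * (card D * card W)"
    proof -
      have "card near \<le> card ((\<lambda>(d, w). word_act G w (f d)) ` (D \<times> W))
          + card ((\<lambda>(d, w). word_act H w (g d)) ` (D \<times> W))"
        unfolding near_def by (rule card_Un_le)
      also have "\<dots> \<le> card (D \<times> W) + card (D \<times> W)"
        using fin finW by (intro add_mono card_image_le) auto
      finally show ?thesis by (simp add: card_cartesian_product)
    qed
    have "near \<subseteq> {1..n}"
    proof -
      have "word_act G w (f d) \<in> {1..n}" "word_act H w (g d) \<in> {1..n}" if "d \<in> D" for d w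
        using word_act_in[OF G] word_act_in[OF H] f g that by blast+
      then show ?thesis
        unfolding near_def by (intro Un_least image_subsetI) (auto simp del: atLeastAtMost_iff)
    qed
    have near: "word_act G w (f d) \<in> near" "word_act H w (g d) \<in> near"
      if "d \<in> D" "length w \<le> m" for d w
      using that unfolding near_def W_def by force+
    have "\<bar>accept_sum n G (Query x a c) b D f - accept_sum n H (Query x a c) b D g\<bar>
      \<le> (\<beta> * real q' + \<beta>) * fact (n - card D)"
    proof (rule accept_sum_new_root[OF D f g, of x "\<beta> * real q'" "B \<union> near"])
      show "f ` D \<subseteq> B \<union> near" "g ` D \<subseteq> B \<union> near"
        using near[of _ "[]"] by auto
      have "real (card (B \<union> near)) \<le> real (card B) + real (card near)"
        using card_Un_le[of B near] by linarith
      also have "real (card near) \<le> 2 * (real (card D) * real (card W))"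
        using card_near by (metis of_nat_le_iff of_nat_mult of_nat_numeral)
      also have "\<dots> \<le> 2 * (real m * real (card W))"
        using m by (intro mult_left_mono mult_right_mono) auto
      finally have "real (card (B \<union> near)) \<le> \<beta> * real (n - m)"
        using \<beta>_bound by (simp add: W_def)
      also have "\<dots> \<le> \<beta> * real (n - card D)"
        using \<beta> m by (intro mult_left_mono) auto
      finally show "real (card (B \<union> near)) \<le> \<beta> * real (n - card D)" .
      fix u assume u: "u \<in> {1..n} - (B \<union> near)"
      have ran: "u \<notin> f ` D" "u \<notin> g ` D" using u near[of _ "[]"] by auto
      have u': "u \<in> {1..n}" using u by simp
      have "\<bar>accept_sum n G (Query x a c) b (insert x D) (f(x := u))
          - accept_sum n H (Query x a c) b (insert x D) (g(x := u))\<bar>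
        \<le> \<beta> * real q' * fact (n - card (insert x D))"
      proof (rule labelled)
        show "inj_on (f(x := u)) (insert x D)" "inj_on (g(x := u)) (insert x D)"
          by (rule inj_on_fun_upd_insert[OF f(1) ran(1)], rule inj_on_fun_upd_insert[OF g(1) ran(2)])
        show "(f(x := u)) ` insert x D \<subseteq> {1..n}" "(g(x := u)) ` insert x D \<subseteq> {1..n}"
          by (rule fun_upd_insert_image_subset[OF f(2) u'], rule fun_upd_insert_image_subset[OF g(2) u'])
        show "locally_alike G H (2 * Suc q') (insert x D) (f(x := u)) (g(x := u))"
        proof (rule locally_alike_new_root[OF G H f(2) g(2) _ False u'])
          show "locally_alike G H (2 * Suc q') D f g" using alike q by simp
          show "word_act G w u = u \<longleftrightarrow> word_act H w u = u" if "length w \<le> 2 * Suc q'" for w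
            using B[of u w] u that m q by simp
          show "word_act G w (f d) \<noteq> u \<and> word_act H w (g d) \<noteq> u"
            if "length w \<le> 2 * Suc q'" "d \<in> D" for w d
            using near[OF that(2), of w] u that m q by auto
        qed
      qed (use D x False fin extensions_mono[OF False] in auto)
      then show "\<bar>accept_sum n G (Query x a c) b (insert x D) (f(x := u))
          - accept_sum n H (Query x a c) b (insert x D) (g(x := u))\<bar>
        \<le> \<beta> * real q' * fact (n - Suc (card D))"
        using False fin by simp
    qed (use x False \<beta> B_sub \<open>near \<subseteq> {1..n}\<close> in \<open>auto intro: finite_subset\<close>)
    then show ?thesis using q by (simp add: algebra_simps)
  qed
next
  case (Sample p c)
  let ?\<Delta> = "\<lambda>r. accept_sum n G (c r) b D f - accept_sum n H (c r) b D g"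
  have int: "integrable (measure_pmf p) (\<lambda>r. accept_sum n K (c r) b D h)"
    if "inj_on h D" "h ` D \<subseteq> {1..n}" for K h
  proof -
    have "\<bar>accept_sum n K (c r) b D h\<bar> \<le> fact (n - card D)" for r
      using accept_sum_bounds[OF Sample.prems(1) that, of K "c r" b] by simp
    then show ?thesis
      by (intro measure_pmf.integrable_const_bound[where B = "fact (n - card D)"]) auto
  qed
  note ints = int[OF Sample.prems(2,3), of G] int[OF Sample.prems(4,5), of H]
  \<comment> \<open>The random draw is shared by both runs, so the estimate is made for each outcome
    separately and then averaged.\<close>
  have bound: "\<bar>?\<Delta> r\<bar> \<le> \<beta> * real q * fact (n - card D)" if "r \<in> set_pmf p" for r
    using Sample.IH[OF rangeI Sample.prems(1-7)] Sample.prems(8) that by simp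
  have "\<bar>accept_sum n G (Sample p c) b D f - accept_sum n H (Sample p c) b D g\<bar>
      = \<bar>\<integral>r. ?\<Delta> r \<partial>measure_pmf p\<bar>"
    using ints by (simp add: accept_sum_Sample)
  also have "\<dots> \<le> (\<integral>r. \<bar>?\<Delta> r\<bar> \<partial>measure_pmf p)" by (rule integral_abs_bound)
  also have "\<dots> \<le> \<beta> * real q * fact (n - card D)"
    using ints bound by (intro measure_pmf.integral_le_const) (auto intro!: AE_pmfI)
  finally show ?case .
qed

section \<open>From testers to statistical distinguishability\<close>

text \<open>Within each type as many points as possible are matched and the rest is completed
  arbitrarily. The truncated subtraction counts the surplus of a type, and only surplus points can
  be mismatched.\<close>

lemma exists_matching_permutation:
  assumes A: "finite A" and T: "finite T" "\<phi> ` A \<subseteq> T"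
  obtains \<pi> where "\<pi> permutes A"
    "card {x \<in> A. \<phi> x \<noteq> \<psi> (\<pi> x)} \<le> (\<Sum>t\<in>T. card {x \<in> A. \<phi> x = t} - card {x \<in> A. \<psi> x = t})"
proof -
  define F where "F t = {x \<in> A. \<phi> x = t}" for t
  define K where "K t = {x \<in> A. \<psi> x = t}" for t
  have fin: "finite (F t)" "finite (K t)" for t using A by (auto simp: F_def K_def)
  have "\<exists>Y j. Y \<subseteq> F t \<and> card Y = min (card (F t)) (card (K t)) \<and> inj_on j Y \<and> j ` Y \<subseteq> K t" for t
  proof -
    obtain Y where Y: "Y \<subseteq> F t" "card Y = min (card (F t)) (card (K t))"
      by (metis min.cobounded1 obtain_subset_with_card_n)
    then obtain j where "inj_on j Y" "j ` Y \<subseteq> K t"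
      using card_le_inj[of Y "K t"] fin finite_subset by (metis min.cobounded2)
    then show ?thesis using Y by blast
  qed
  then obtain Y j where Y: "Y t \<subseteq> F t" "card (Y t) = min (card (F t)) (card (K t))"
    and j: "inj_on (j t) (Y t)" "j t ` Y t \<subseteq> K t" for t by metis
  define X where "X = {x \<in> A. x \<in> Y (\<phi> x)}"
  define h where "h x = j (\<phi> x) x" for x
  have h: "h x \<in> A \<and> \<psi> (h x) = \<phi> x" if "x \<in> X" for x
    using that j(2)[of "\<phi> x"] by (auto simp: X_def h_def K_def)
  have inj: "inj_on h X"
  proof (rule inj_onI)
    fix x y assume xy: "x \<in> X" "y \<in> X" "h x = h y"
    then have "\<phi> x = \<phi> y" using h by metis
    then show "x = y" using xy j(1)[of "\<phi> x"] by (auto simp: X_def h_def inj_on_def)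
  qed
  have X: "X \<subseteq> A" "h ` X \<subseteq> A" using h by (auto simp: X_def)
  \<comment> \<open>The unmatched points on both sides are equinumerous, so the partial matching
    \<open>h\<close> extends to a permutation.\<close>
  have "card (A - X) = card (A - h ` X)"
    using X A inj by (simp add: card_Diff_subset finite_subset card_image)
  then obtain k where k: "bij_betw k (A - X) (A - h ` X)"
    using A by (metis finite_Diff finite_same_card_bij)
  define \<pi> where "\<pi> x = (if x \<in> X then h x else if x \<in> A then k x else x)" for x
  have "bij_betw \<pi> X (h ` X)"
    using inj by (auto simp: \<pi>_def bij_betw_def inj_on_def)
  moreover have "bij_betw \<pi> (A - X) (A - h ` X)"
    using k by (rule bij_betw_cong[THEN iffD1, rotated]) (simp add: \<pi>_def)
  ultimately have "bij_betw \<pi> (X \<union> (A - X)) (h ` X \<union> (A - h ` X))"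
    by (rule bij_betw_combine) auto
  then have "bij_betw \<pi> A A" using X by (simp add: Un_absorb1)
  then have perm: "\<pi> permutes A" by (rule bij_imp_permutes) (use X in \<open>auto simp: \<pi>_def\<close>)
  have "{x \<in> A. \<phi> x \<noteq> \<psi> (\<pi> x)} \<subseteq> (\<Union>t\<in>T. F t - Y t)"
  proof
    fix x assume x: "x \<in> {x \<in> A. \<phi> x \<noteq> \<psi> (\<pi> x)}"
    then have "x \<notin> X" using h by (auto simp: \<pi>_def)
    then show "x \<in> (\<Union>t\<in>T. F t - Y t)" using x T by (auto simp: X_def F_def)
  qed
  then have "card {x \<in> A. \<phi> x \<noteq> \<psi> (\<pi> x)} \<le> card (\<Union>t\<in>T. F t - Y t)"
    using T fin by (intro card_mono) auto
  also have "\<dots> \<le> (\<Sum>t\<in>T. card (F t - Y t))" by (rule card_UN_le[OF T(1)])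
  also have "\<dots> = (\<Sum>t\<in>T. card (F t) - card (K t))"
    using card_Diff_subset[OF finite_subset[OF Y(1) fin(1)] Y(1)] Y(2)
    by (intro sum.cong) (auto simp: min_def)
  finally show ?thesis using that[OF perm] by (simp add: F_def K_def)
qed

text \<open>A vertex of \<open>H\<close> violating a relation has a type that omits its relator,
  while every vertex of \<open>G\<close> has the relator in its type. One vertex has mass
  \<open>1 / n\<close>, and \<open>tv_dist\<close> halves it.\<close>

lemma tv_dist_relator_statistics:
  assumes n: "n \<ge> 1" and G: "G \<in> GSol E n" and H: "H \<in> sgraphs n" "H \<notin> GSol E n"
    and P: "finite P" "(\<lambda>(u, v). reduce (inv_word v @ u)) ` E \<subseteq> P"
  shows "tv_dist (Pow P) (stat n G P) (stat n H P) \<ge> 1 / (2 * real n)"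
proof -
  obtain u v x where uv: "(u, v) \<in> E" and x: "x \<in> {1..n}" and neq: "word_act H u x \<noteq> word_act H v x"
    using H unfolding GSol_def by blast
  define r where "r = reduce (inv_word v @ u)"
  have r: "r \<in> stab K y \<longleftrightarrow> word_act K u y = word_act K v y" if "K \<in> sgraphs n" "y \<in> {1..n}" for K y
    unfolding r_def using reduce_in_stab_iff[OF that] word_act_eq_iff[OF that that(2)] by metis
  have rP: "r \<in> P" using P uv by (auto simp: r_def)
  define T where "T = stab H x \<inter> P"
  have "r \<notin> T" using r[OF H(1) x] neq by (simp add: T_def)
  have "{y \<in> {1..n}. stab G y \<inter> P = T} = {}"
  proof (intro equals0I)
    fix y assume "y \<in> {y \<in> {1..n}. stab G y \<inter> P = T}"
    then have y: "y \<in> {1..n}" "stab G y \<inter> P = T" by auto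
    have "word_act G u y = word_act G v y" using G uv y by (auto simp: GSol_def)
    then have "r \<in> stab G y" using r[of G y] G y by (simp add: GSol_def)
    then show False using y rP \<open>r \<notin> T\<close> by blast
  qed
  then have 0: "pmf (stat n G P) T = 0" unfolding pmf_stat[OF n] by (simp only: card.empty)
  have "card {x} \<le> card {y \<in> {1..n}. stab H y \<inter> P = T}"
    using x by (intro card_mono) (auto simp: T_def)
  then have 1: "pmf (stat n H P) T \<ge> 1 / real n"
    unfolding pmf_stat[OF n] by (intro divide_right_mono) auto
  have "\<bar>pmf (stat n G P) T - pmf (stat n H P) T\<bar>
      \<le> (\<Sum>T\<in>Pow P. \<bar>pmf (stat n G P) T - pmf (stat n H P) T\<bar>)"
    by (rule member_le_sum) (use P in \<open>auto simp: T_def\<close>)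
  then show ?thesis using 0 1 by (simp add: tv_dist_def)
qed

text \<open>If the statistics were closer, \<open>H\<close> could be relabelled to agree locally
  with \<open>G\<close> at most vertices. The averaged acceptance probabilities would then differ by
  at most 1/2, whereas a tester separates them by 0.98.\<close>

lemma tv_dist_stat_tester:
  fixes E :: "('s::finite) relations"
  assumes tester: "is_tester E \<epsilon> q M"
    and G: "G \<in> GSol E n" and H: "H \<in> GSol_far E \<epsilon> n"
    and P: "finite P" "{w \<in> reduced_words. length w \<le> 2 * q} \<subseteq> P"
    and n: "n \<ge> 1" "32 * q * (q + 1) * card {w :: 's word. length w \<le> 2 * q} + 4 * q \<le> n"
  shows "tv_dist (Pow P) (stat n G P) (stat n H P) \<ge> 1 / (16 * (real q + 1))"
proof (rule ccontr)
  define K where "K = card {w :: 's word. length w \<le> 2 * q}"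
  define tv where "tv = tv_dist (Pow P) (stat n G P) (stat n H P)"
  assume "\<not> ?thesis"
  then have tv: "tv < 1 / (16 * (real q + 1))" by (simp add: tv_def)
  have Gs: "G \<in> sgraphs n" and Hs: "H \<in> sgraphs n" using G H by (auto simp: GSol_def GSol_far_def)
  define \<phi> where "\<phi> x = stab G x \<inter> P" for x
  define \<psi> where "\<psi> x = stab H x \<inter> P" for x
  obtain \<pi> where \<pi>: "\<pi> permutes {1..n}"
    and card_le: "card {x \<in> {1..n}. \<phi> x \<noteq> \<psi> (\<pi> x)}
      \<le> (\<Sum>T\<in>Pow P. card {x \<in> {1..n}. \<phi> x = T} - card {x \<in> {1..n}. \<psi> x = T})"
  proof (rule exists_matching_permutation[of "{1..n}" "Pow P" \<phi> \<psi>])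
    show "\<phi> ` {1..n} \<subseteq> Pow P" by (auto simp: \<phi>_def)
  qed (use P in auto)
  define B where "B = {x \<in> {1..n}. \<phi> x \<noteq> \<psi> (\<pi> x)}"
  \<comment> \<open>The label \<open>x\<close> now denotes the vertex \<open>\<pi> x\<close> of
    \<open>H\<close>, so the types in \<open>G\<close> and \<open>H'\<close> agree outside
    \<open>B\<close>.\<close>
  define H' where "H' = relabel \<pi> H"
  have H': "H' \<in> GSol_far E \<epsilon> n" "H' \<in> sgraphs n"
    unfolding H'_def by (rule relabel_GSol_far[OF H \<pi>], rule relabel_sgraphs[OF Hs \<pi>])
  have "real (card B) \<le> (\<Sum>T\<in>Pow P.
      \<bar>real (card {x \<in> {1..n}. \<phi> x = T}) - real (card {x \<in> {1..n}. \<psi> x = T})\<bar>)"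
    unfolding B_def
    by (rule order_trans[OF of_nat_mono[OF card_le]]) (simp only: of_nat_sum, rule sum_mono, linarith)
  also have "\<dots> = (\<Sum>T\<in>Pow P. real n * \<bar>pmf (stat n G P) T - pmf (stat n H P) T\<bar>)"
    unfolding pmf_stat[OF n(1)] \<phi>_def \<psi>_def diff_divide_distrib[symmetric] using n
    by (intro sum.cong) auto
  also have "\<dots> = 2 * real n * tv"
    by (simp add: tv_def tv_dist_def sum_distrib_left)
  also have "\<dots> \<le> 2 * real n * (1 / (16 * (real q + 1)))"
    using tv by (intro mult_left_mono) auto
  finally have card_B: "real (card B) \<le> real n / (8 * (real q + 1))" by (simp add: field_simps)
  \<comment> \<open>Chosen so that the total loss \<open>\<beta> * q\<close> stays below
    1/2.\<close>
  define \<beta> where "\<beta> = 1 / (2 * (real q + 1))"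
  have "\<bar>accept_sum n G (M n) True {} id - accept_sum n H' (M n) True {} id\<bar>
      \<le> \<beta> * real q * fact (n - card ({} :: nat set))"
  proof (rule accept_sum_close[OF Gs H'(2), of _ B "2 * q"])
    show "word_act G w u = u \<longleftrightarrow> word_act H' w u = u" if u: "u \<in> {1..n} - B" and w: "length w \<le> 2 * q" for u w
    proof -
      have "reduce w \<in> P" using P w reduce_reduced[of w] length_reduce_le[of w] by auto
      moreover have "stab G u \<inter> P = stab H' u \<inter> P"
        using u stab_relabel[OF Hs \<pi>, of u] by (auto simp: B_def \<phi>_def \<psi>_def H'_def)
      ultimately have "reduce w \<in> stab G u \<longleftrightarrow> reduce w \<in> stab H' u" by blast
      then show ?thesis
        using reduce_in_stab_iff[OF Gs, of u w] reduce_in_stab_iff[OF H'(2), of u w] u by blast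
    qed
    \<comment> \<open>The lower bound on \<open>n\<close> makes the balls as small as the bound for
      \<open>B\<close>, namely \<open>n / (8 * (q + 1))\<close>. Together they give
      \<open>\<beta> * n / 2\<close>, and \<open>4 * q \<le> n\<close> absorbs the passage to
      \<open>n - 2 * q\<close>.\<close>
    have "32 * real q * (real q + 1) * real K \<le> real n"
    proof -
      have "32 * q * (q + 1) * K \<le> n" using n(2) by (simp add: K_def)
      then have "real (32 * q * (q + 1) * K) \<le> real n" by (rule of_nat_mono)
      then show ?thesis by (simp add: algebra_simps)
    qed
    then have "2 * real (2 * q) * real K \<le> real n / (8 * (real q + 1))"
      by (simp add: field_simps)
    then have "real (card B) + 2 * real (2 * q) * real K \<le> real n / (4 * (real q + 1))"
      using card_B by (simp add: field_simps)
    also have "\<dots> = \<beta> * (real n / 2)" by (simp add: \<beta>_def)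
    also have "\<dots> \<le> \<beta> * real (n - 2 * q)"
      using n(2) by (intro mult_left_mono) (auto simp: \<beta>_def)
    finally show "real (card B) + 2 * real (2 * q) * real (card {w :: 's word. length w \<le> 2 * q})
        \<le> \<beta> * real (n - 2 * q)" by (simp add: K_def)
    show "queries_at_most n (relabel \<sigma> G) q (M n)" if "\<sigma> \<in> extensions {1..n} {} id" for \<sigma>
      using tester n relabel_sgraphs[OF Gs, of \<sigma>] that by (simp add: is_tester_def extensions_def)
  qed (auto simp: locally_alike_def \<beta>_def B_def)
  also have "\<dots> \<le> 1 / 2 * fact n"
    by (simp add: \<beta>_def field_simps)
  finally have close: "\<bar>accept_sum n G (M n) True {} id - accept_sum n H' (M n) True {} id\<bar> \<le> 1 / 2 * fact n" .
  have card_ext: "real (card (extensions {1..n} {} id)) = fact n"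
    by (simp add: card_extensions)
  have "real (card (extensions {1..n} {} id)) * 0.99 \<le> accept_sum n G (M n) True {} id"
    unfolding accept_sum_def
    by (rule sum_bounded_below)
      (use tester n relabel_GSol[OF G] in \<open>auto simp: is_tester_def extensions_def\<close>)
  moreover have "accept_sum n H' (M n) True {} id \<le> real (card (extensions {1..n} {} id)) * 0.01"
    unfolding accept_sum_def
  proof (rule sum_bounded_above)
    fix \<sigma> assume "\<sigma> \<in> extensions {1..n} {} id"
    then have "relabel \<sigma> H' \<in> GSol_far E \<epsilon> n"
      using relabel_GSol_far[OF H'(1)] by (simp add: extensions_def)
    then have "pmf (run (relabel \<sigma> H') (M n)) False \<ge> 0.99"
      using tester n by (simp add: is_tester_def)
    then show "pmf (run (relabel \<sigma> H') (M n)) True \<le> 0.01" by (simp add: pmf_False_conv_True)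
  qed
  ultimately have "fact n * (0.99 - 0.01) \<le> fact n * (1 / 2 :: real)"
    using close unfolding card_ext right_diff_distrib by linarith
  then show False by simp
qed

lemma testable_imp_statistically_distinguishable:
  fixes E :: "('s::finite) relations"
  assumes "finite E" "testable E"
  shows "statistically_distinguishable E"
  unfolding statistically_distinguishable_def
proof (intro allI impI)
  fix \<epsilon> :: real assume \<epsilon>: "\<epsilon> > 0"
  obtain M where "family_of_testers E M" using assms(2) by (auto simp: testable_def)
  then obtain q where tester: "is_tester E \<epsilon> q (M \<epsilon>)"
    using \<epsilon> by (auto simp: family_of_testers_def)
  \<comment> \<open>The threshold of \<open>tv_dist_stat_tester\<close>, plus 1 to keep it positive
    as a denominator.\<close>
  define N where "N = 32 * q * (q + 1) * card {w :: 's word. length w \<le> 2 * q} + 4 * q + 1"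
  \<comment> \<open>The short words serve the case of large \<open>n\<close>, the relators the case
    of small \<open>n\<close>.\<close>
  define P where "P = {w \<in> reduced_words. length w \<le> 2 * q} \<union> (\<lambda>(u, v). reduce (inv_word v @ u)) ` E"
  define \<delta> where "\<delta> = min (1 / (16 * (real q + 1))) (1 / (2 * real N))"
  have finP: "finite P"
    using assms(1) finite_subset[OF _ finite_words_length_le[of "2 * q"],
        of "{w \<in> reduced_words. length w \<le> 2 * q}"]
    by (auto simp: P_def)
  have "tv_dist (Pow P) (stat n G P) (stat n H P) \<ge> \<delta>"
    if n: "n \<ge> 1" and G: "G \<in> GSol E n" and H: "H \<in> GSol_far E \<epsilon> n" for n G H
  proof (cases "N \<le> n")
    case True
    have "tv_dist (Pow P) (stat n G P) (stat n H P) \<ge> 1 / (16 * (real q + 1))"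
      by (rule tv_dist_stat_tester[OF tester G H finP _ n]) (use True in \<open>auto simp: P_def N_def\<close>)
    then show ?thesis by (simp add: \<delta>_def)
  next
    case False
    have "tv_dist (Pow P) (stat n G P) (stat n H P) \<ge> 1 / (2 * real n)"
      by (rule tv_dist_relator_statistics[OF n G _ GSol_far_not_GSol[OF \<epsilon> H] finP])
        (use H in \<open>auto simp: P_def GSol_far_def\<close>)
    moreover have "1 / (2 * real N) \<le> 1 / (2 * real n)"
      using False n by (intro divide_left_mono) auto
    ultimately show ?thesis by (simp add: \<delta>_def)
  qed
  moreover have "\<delta> > 0"
  proof -
    have "N > 0" by (simp add: N_def)
    then show ?thesis by (simp add: \<delta>_def)
  qed
  moreover have "P \<in> fin_subsets reduced_words"
    using finP reduce_reduced by (auto simp: fin_subsets_def P_def)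
  ultimately show "\<exists>P\<in>fin_subsets reduced_words. \<exists>\<delta>>0. \<forall>n\<ge>1. \<forall>G\<in>GSol E n. \<forall>H\<in>GSol_far E \<epsilon> n.
      \<delta> \<le> tv_dist (Pow P) (stat n G P) (stat n H P)" by blast
qed

section \<open>Empirical statistics\<close>

lemma finite_set_replicate_pmf: "finite (set_pmf p) \<Longrightarrow> finite (set_pmf (replicate_pmf k p))"
  using finite_lists_length_eq[of "set_pmf p" k] by (simp add: set_replicate_pmf lists_eq_set conj_commute)

lemma expectation_replicate_pmf_Suc:
  fixes h :: "'a list \<Rightarrow> real"
  assumes "finite (set_pmf p)"
  shows "measure_pmf.expectation (replicate_pmf (Suc k) p) h =
    (\<Sum>a\<in>set_pmf p. pmf p a * measure_pmf.expectation (replicate_pmf k p) (\<lambda>xs. h (a # xs)))"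
  by (simp flip: map_pmf_def add: pmf_expectation_bind[OF assms] finite_set_replicate_pmf[OF assms])

text \<open>The centred count is a sum of independent centred indicators bounded by 1. Splitting off
  the first sample, the mixed term vanishes and each sample adds at most 1 to the variance.\<close>

lemma count_list_moments:
  fixes p :: "'a pmf" and t :: 'a
  assumes fin: "finite (set_pmf p)"
  defines "X \<equiv> \<lambda>k xs. real (count_list xs t) - real k * pmf p t"
  shows "measure_pmf.expectation (replicate_pmf k p) (X k) = 0"
    "measure_pmf.expectation (replicate_pmf k p) (\<lambda>xs. (X k xs)\<^sup>2) \<le> real k"
proof -
  \<comment> \<open>The centred contribution of a single sample.\<close>
  define c where "c a = indicat_real {t} a - pmf p t" for a
  have X_Cons: "X (Suc k) (a # xs) = c a + X k xs" for k a xs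
    by (simp add: X_def c_def algebra_simps)
  have int: "integrable (measure_pmf (replicate_pmf k p)) h" for k and h :: "_ \<Rightarrow> real"
    by (rule integrable_measure_pmf_finite[OF finite_set_replicate_pmf[OF fin]])
  have sum1: "(\<Sum>a\<in>set_pmf p. pmf p a) = 1" using sum_pmf_eq_1[OF fin] by simp
  have sumc: "(\<Sum>a\<in>set_pmf p. pmf p a * c a) = 0"
  proof -
    have "(\<Sum>a\<in>set_pmf p. pmf p a * c a)
        = (\<Sum>a\<in>set_pmf p. if a = t then pmf p t else 0) - pmf p t * (\<Sum>a\<in>set_pmf p. pmf p a)"
      unfolding sum_distrib_left sum_subtractf[symmetric]
      by (intro sum.cong) (auto simp: c_def algebra_simps)
    also have "(\<Sum>a\<in>set_pmf p. if a = t then pmf p t else 0) = pmf p t"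
      using fin by (auto simp: sum.delta' set_pmf_iff)
    finally show ?thesis using sum1 by simp
  qed
  have mean: "measure_pmf.expectation (replicate_pmf k p) (X k) = 0" for k
  proof (induction k)
    case (Suc k)
    have "measure_pmf.expectation (replicate_pmf k p) (\<lambda>xs. X (Suc k) (a # xs)) = c a" for a
      using Suc int by (simp add: X_Cons)
    then show ?case using sumc by (simp add: expectation_replicate_pmf_Suc[OF fin] del: replicate_pmf.simps)
  qed (simp add: X_def)
  show "measure_pmf.expectation (replicate_pmf k p) (X k) = 0" by (rule mean)
  show "measure_pmf.expectation (replicate_pmf k p) (\<lambda>xs. (X k xs)\<^sup>2) \<le> real k"
  proof (induction k)
    case (Suc k)
    have "measure_pmf.expectation (replicate_pmf k p) (\<lambda>xs. (X (Suc k) (a # xs))\<^sup>2) \<le> 1 + real k" for a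
    proof -
      have "measure_pmf.expectation (replicate_pmf k p) (\<lambda>xs. (X (Suc k) (a # xs))\<^sup>2)
        = measure_pmf.expectation (replicate_pmf k p) (\<lambda>xs. (c a)\<^sup>2 + 2 * c a * X k xs + (X k xs)\<^sup>2)"
        by (simp add: X_Cons power2_sum algebra_simps)
      also have "\<dots> = (c a)\<^sup>2 + measure_pmf.expectation (replicate_pmf k p) (\<lambda>xs. (X k xs)\<^sup>2)"
        using mean[of k] int by simp
      also have "(c a)\<^sup>2 \<le> 1"
        unfolding c_def abs_square_le_1 using pmf_le_1[of p t] pmf_nonneg[of p t]
        by (auto simp: indicator_def)
      finally show ?thesis using Suc by simp
    qed
    then have "measure_pmf.expectation (replicate_pmf (Suc k) p) (\<lambda>xs. (X (Suc k) xs)\<^sup>2)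
      \<le> (\<Sum>a\<in>set_pmf p. pmf p a * (1 + real k))"
      unfolding expectation_replicate_pmf_Suc[OF fin] by (intro sum_mono mult_left_mono) auto
    also have "\<dots> = real (Suc k)" using sum1 by (simp flip: sum_distrib_right)
    finally show ?case .
  qed (simp add: X_def)
qed

lemma pmf_empirical:
  assumes "Ts \<noteq> []"
  shows "pmf (empirical Ts) T = real (count_list Ts T) / real (length Ts)"
proof -
  have "pmf (empirical Ts) T = measure (pmf_of_set {..<length Ts}) ((\<lambda>j. Ts ! j) -` {T})"
    by (simp add: empirical_def pmf_map)
  also have "\<dots> = real (card ({..<length Ts} \<inter> (\<lambda>j. Ts ! j) -` {T})) / real (length Ts)"
    using assms by (subst measure_pmf_of_set) auto
  also have "{..<length Ts} \<inter> (\<lambda>j. Ts ! j) -` {T} = {j. j < length Ts \<and> T = Ts ! j}"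
    by auto
  finally show ?thesis by (simp add: count_list_eq_length_filter length_filter_conv_card)
qed

text \<open>Cauchy-Schwarz bounds the squared distance by the squared deviations of the single
  counts, whose expectations are known; Markov's inequality for the square then gives the
  tail.\<close>

lemma empirical_concentration:
  assumes fin: "finite (set_pmf p)" and \<Omega>: "finite \<Omega>" and k: "k \<ge> 1" and \<delta>: "\<delta> > 0"
  shows "measure (measure_pmf (replicate_pmf k p)) {Ts. tv_dist \<Omega> (empirical Ts) p \<ge> \<delta>}
    \<le> (real (card \<Omega>))\<^sup>2 / (real k * \<delta>\<^sup>2)"
proof -
  define R where "R = measure_pmf (replicate_pmf k p)"
  define X where "X t xs = real (count_list xs t) - real k * pmf p t" for t xs
  have int: "integrable R h" for h :: "_ \<Rightarrow> real"
    unfolding R_def by (rule integrable_measure_pmf_finite[OF finite_set_replicate_pmf[OF fin]])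
  \<comment> \<open>Restricted to the support, where the list has length \<open>k\<close> and is
    therefore nonempty; below, the bound is used almost everywhere.\<close>
  have tv: "(tv_dist \<Omega> (empirical Ts) p)\<^sup>2 \<le> real (card \<Omega>) / (real k)\<^sup>2 * (\<Sum>t\<in>\<Omega>. (X t Ts)\<^sup>2)"
    if "Ts \<in> set_pmf (replicate_pmf k p)" for Ts
  proof -
    have len: "length Ts = k" using that by (simp add: set_replicate_pmf)
    then have "Ts \<noteq> []" using k by auto
    then have diff: "pmf (empirical Ts) t - pmf p t = X t Ts / real k" for t
      using len k by (simp add: pmf_empirical X_def field_simps)
    have "(tv_dist \<Omega> (empirical Ts) p)\<^sup>2 = 1 / 4 * (\<Sum>t\<in>\<Omega>. \<bar>X t Ts / real k\<bar>)\<^sup>2"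
      by (simp only: tv_dist_def diff power_mult_distrib) (simp add: power2_eq_square)
    \<comment> \<open>The factor 1/4 is given away.\<close>
    also have "\<dots> \<le> 1 * ((\<Sum>t\<in>\<Omega>. \<bar>X t Ts / real k\<bar>\<^sup>2) * real (card \<Omega>))"
      by (intro mult_mono sum_squared_le_sum_of_squares) auto
    also have "\<dots> = real (card \<Omega>) / (real k)\<^sup>2 * (\<Sum>t\<in>\<Omega>. (X t Ts)\<^sup>2)"
      by (simp add: power_divide sum_divide_distrib[symmetric])
    finally show ?thesis .
  qed
  have "measure R {Ts. tv_dist \<Omega> (empirical Ts) p \<ge> \<delta>}
      \<le> measure R {Ts \<in> space R. \<delta>\<^sup>2 \<le> (tv_dist \<Omega> (empirical Ts) p)\<^sup>2}"
    unfolding R_def using \<delta> by (intro measure_pmf.finite_measure_mono) (auto intro: power_mono)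
  also have "\<dots> \<le> (\<integral>Ts. (tv_dist \<Omega> (empirical Ts) p)\<^sup>2 \<partial>R) / \<delta>\<^sup>2"
    using \<delta> by (intro integral_Markov_inequality_measure[where A = "{}"] int) (auto simp: R_def)
  also have "(\<integral>Ts. (tv_dist \<Omega> (empirical Ts) p)\<^sup>2 \<partial>R)
      \<le> (\<integral>Ts. real (card \<Omega>) / (real k)\<^sup>2 * (\<Sum>t\<in>\<Omega>. (X t Ts)\<^sup>2) \<partial>R)"
  proof (rule integral_mono_AE[OF int int])
    show "AE Ts in R. (tv_dist \<Omega> (empirical Ts) p)\<^sup>2
        \<le> real (card \<Omega>) / (real k)\<^sup>2 * (\<Sum>t\<in>\<Omega>. (X t Ts)\<^sup>2)"
      unfolding R_def using tv by (rule AE_pmfI)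
  qed
  also have "\<dots> = real (card \<Omega>) / (real k)\<^sup>2 * (\<Sum>t\<in>\<Omega>. \<integral>Ts. (X t Ts)\<^sup>2 \<partial>R)"
    using int by simp
  also have "\<dots> \<le> real (card \<Omega>) / (real k)\<^sup>2 * (\<Sum>t\<in>\<Omega>. real k)"
    unfolding R_def X_def
    by (intro mult_left_mono sum_mono count_list_moments(2)[OF fin]) auto
  also have "\<dots> = (real (card \<Omega>))\<^sup>2 / real k"
    using k by (simp add: power2_eq_square)
  finally show ?thesis
    using \<delta> by (simp add: R_def divide_right_mono)
qed

section \<open>The Local Statistics Matcher\<close>

lemma run_bind_algo: "run G (bind_algo A f) = bind_pmf (run G A) (\<lambda>a. run G (f a))"
  by (induction A) (simp_all add: bind_return_pmf bind_assoc_pmf)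

lemma queries_at_most_mono: "queries_at_most n G q A \<Longrightarrow> q \<le> q' \<Longrightarrow> queries_at_most n G q' A"
proof (induction A arbitrary: q q')
  case (Query x a c)
  have "queries_at_most n G (q - 1) (c (letter_act G a x))" "q - 1 \<le> q' - 1"
    using Query.prems by (simp_all add: diff_le_mono)
  then have "queries_at_most n G (q' - 1) (c (letter_act G a x))"
    by (rule Query.IH[OF rangeI])
  then show ?case using Query.prems by simp
qed auto

text \<open>The continuation is constrained only on results that can occur on \<open>G\<close>; this
  is what keeps later queries at vertices of \<open>G\<close>.\<close>

lemma queries_at_most_bind:
  assumes "queries_at_most n G q A" "\<And>a. a \<in> set_pmf (run G A) \<Longrightarrow> queries_at_most n G q' (f a)"
  shows "queries_at_most n G (q + q') (bind_algo A f)"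
  using assms
proof (induction A arbitrary: q)
  case (Return a)
  then show ?case by (auto intro: queries_at_most_mono[of n G q'])
next
  case (Query x a c)
  have "queries_at_most n G (q - 1 + q') (bind_algo (c (letter_act G a x)) f)"
    using Query.prems by (intro Query.IH[OF rangeI]) auto
  then show ?case using Query.prems(1) by simp
next
  case (Sample p c)
  show ?case using Sample.prems by (auto intro!: Sample.IH)
qed

lemma run_sample_vertices: "run G (sample_vertices n k) = replicate_pmf k (pmf_of_set {1..n})"
  by (induction k) (simp_all add: run_bind_algo)

lemma queries_at_most_sample_vertices: "queries_at_most n G 0 (sample_vertices n k)"
proof (induction k)
  case (Suc k)
  have "queries_at_most n G (0 + 0) (bind_algo (sample_vertices n k) (\<lambda>xs. Return (x # xs)))" for x
    using Suc by (intro queries_at_most_bind) auto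
  then show ?case by simp
qed simp

lemma run_query_word: "run G (query_word w x) = return_pmf (word_act G w x)"
  by (induction w) (simp_all add: run_bind_algo bind_return_pmf del: letter_act.simps)

lemma queries_at_most_query_word:
  assumes "G \<in> sgraphs n" "x \<in> {1..n}"
  shows "queries_at_most n G (length w) (query_word w x)"
proof (induction w)
  case (Cons a w)
  have "queries_at_most n G (length w + 1) (bind_algo (query_word w x) (\<lambda>y. Query y a Return))"
    using Cons word_act_in[OF assms] by (intro queries_at_most_bind) (auto simp: run_query_word)
  then show ?case by simp
qed simp

lemma run_query_stab: "run G (query_stab ws x) = return_pmf {w \<in> set ws. word_act G w x = x}"
proof (induction ws)
  case (Cons w ws)
  have "{v \<in> set (w # ws). word_act G v x = x} =
    (if word_act G w x = x then insert w {v \<in> set ws. word_act G v x = x}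
     else {v \<in> set ws. word_act G v x = x})" by auto
  then show ?case by (simp add: run_bind_algo run_query_word Cons.IH bind_return_pmf)
qed simp

lemma queries_at_most_query_stab:
  assumes "G \<in> sgraphs n" "x \<in> {1..n}"
  shows "queries_at_most n G (sum_list (map length ws)) (query_stab ws x)"
proof (induction ws)
  case (Cons w ws)
  \<comment> \<open>One summand for each bind, with 0 for the final \<open>Return\<close>.\<close>
  have "queries_at_most n G (length w + (sum_list (map length ws) + 0)) (query_stab (w # ws) x)"
    unfolding query_stab.simps
    using Cons by (intro queries_at_most_bind queries_at_most_query_word[OF assms]) auto
  then show ?case by simp
qed simp

lemma run_query_stabs:
  "run G (query_stabs ws xs) = return_pmf (map (\<lambda>x. {w \<in> set ws. word_act G w x = x}) xs)"
  by (induction xs) (simp_all add: run_bind_algo run_query_stab bind_return_pmf)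

lemma queries_at_most_query_stabs:
  assumes "G \<in> sgraphs n" "set xs \<subseteq> {1..n}"
  shows "queries_at_most n G (length xs * sum_list (map length ws)) (query_stabs ws xs)"
  using assms(2)
proof (induction xs)
  case (Cons x xs)
  let ?L = "sum_list (map length ws)"
  have "queries_at_most n G (?L + (length xs * ?L + 0)) (query_stabs ws (x # xs))"
    unfolding query_stabs.simps
    using Cons by (intro queries_at_most_bind queries_at_most_query_stab[OF assms(1)]) auto
  then show ?case by simp
qed simp

lemma map_replicate_pmf: "map_pmf (map f) (replicate_pmf k p) = replicate_pmf k (map_pmf f p)"
proof (induction k)
  case (Suc k)
  show ?case
    by (simp add: Suc.IH[symmetric] map_bind_pmf bind_map_pmf map_pmf_comp flip: map_pmf_def)
qed simp

context
  fixes P :: "('s::finite) word set" and ws :: "'s word list"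
  assumes P: "P \<in> fin_subsets reduced_words"
  defines "ws \<equiv> SOME ws. distinct ws \<and> set ws = P"
begin

lemma set_query_order: "set ws = P"
proof -
  have "\<exists>ws. distinct ws \<and> set ws = P"
    using P finite_distinct_list[of P] by (auto simp: fin_subsets_def)
  then show ?thesis unfolding ws_def by (rule someI2_ex) auto
qed

text \<open>Mapping independent uniform vertices to their types gives independent samples from
  \<open>stat n G P\<close>, so the matcher sees the graph only through its statistics.\<close>

lemma run_LSM:
  "run G (LSM E k P \<delta> n) = map_pmf
     (\<lambda>Ts. Min ((\<lambda>H. tv_dist (Pow P) (empirical Ts) (stat n H P)) ` GSol E n) \<le> \<delta>)
     (replicate_pmf k (stat n G P))"
proof -
  have "{w \<in> P. word_act G w x = x} = stab G x \<inter> P" for x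
    using P by (auto simp: stab_def fin_subsets_def)
  then have "run G (query_stabs ws xs) = return_pmf (map (\<lambda>x. stab G x \<inter> P) xs)" for xs
    by (simp add: run_query_stabs set_query_order)
  then show ?thesis
    unfolding LSM_def ws_def[symmetric] stat_def map_replicate_pmf[symmetric]
    by (simp add: run_bind_algo run_sample_vertices bind_return_pmf map_pmf_comp flip: map_pmf_def)
qed

lemma queries_at_most_LSM:
  assumes "G \<in> sgraphs n" "n \<ge> 1"
  shows "queries_at_most n G (k * sum_list (map length ws)) (LSM E k P \<delta> n)"
proof -
  have "queries_at_most n G (0 + (k * sum_list (map length ws) + 0)) (LSM E k P \<delta> n)"
    unfolding LSM_def ws_def[symmetric]
  proof (rule queries_at_most_bind[OF queries_at_most_sample_vertices], rule queries_at_most_bind)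
    fix xs assume "xs \<in> set_pmf (run G (sample_vertices n k))"
    then have "set xs \<subseteq> {1..n}" "length xs = k"
      using assms by (auto simp: run_sample_vertices set_replicate_pmf)
    then show "queries_at_most n G (k * sum_list (map length ws)) (query_stabs ws xs)"
      using queries_at_most_query_stabs[OF assms(1)] by blast
  qed simp
  then show ?thesis by simp
qed

text \<open>With probability at least 0.99 the empirical distribution is within
  \<open>\<delta> / 3\<close> of the true one. A solution then matches itself, while a far graph is
  more than \<open>2 * \<delta> / 3\<close> away from every solution. The bound on \<open>k\<close>
  makes the failure probability at most 1/100.\<close>

lemma LSM_is_tester:
  assumes \<delta>: "\<delta> > 0" and k: "k \<ge> 1" "100 * (real (card (Pow P)))\<^sup>2 / (\<delta> / 3)\<^sup>2 \<le> real k"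
    and dist: "\<And>n G H. \<lbrakk>n \<ge> 1; G \<in> GSol E n; H \<in> GSol_far E \<epsilon> n\<rbrakk> \<Longrightarrow>
      tv_dist (Pow P) (stat n G P) (stat n H P) \<ge> \<delta>"
  shows "is_tester E \<epsilon> (k * sum_list (map length ws)) (LSM E k P (\<delta> / 3))"
  unfolding is_tester_def
proof (intro allI impI conjI ballI)
  fix n :: nat assume n: "n \<ge> 1"
  define D where "D Ts H = tv_dist (Pow P) (empirical Ts) (stat n H P)" for Ts H
  have run: "run G (LSM E k P (\<delta> / 3) n) = map_pmf
     (\<lambda>Ts. Min (D Ts ` GSol E n) \<le> \<delta> / 3) (replicate_pmf k (stat n G P))" for G
    unfolding run_LSM D_def ..
  have finP: "finite (Pow P)" using P by (simp add: fin_subsets_def)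
  have close: "measure (measure_pmf (replicate_pmf k (stat n G P))) {Ts. D Ts G < \<delta> / 3} \<ge> 0.99" for G
  proof -
    let ?R = "measure_pmf (replicate_pmf k (stat n G P))"
    have "finite (set_pmf (stat n G P))" using n by (simp add: stat_def)
    then have "measure ?R {Ts. \<delta> / 3 \<le> D Ts G} \<le> (real (card (Pow P)))\<^sup>2 / (real k * (\<delta> / 3)\<^sup>2)"
      unfolding D_def using empirical_concentration[of "stat n G P" "Pow P" k "\<delta> / 3"] finP k \<delta> by simp
    also have "\<dots> \<le> 1 / 100" using k \<delta> by (simp add: field_simps)
    finally have "measure ?R {Ts. \<delta> / 3 \<le> D Ts G} \<le> 1 / 100" .
    moreover have "{Ts. D Ts G < \<delta> / 3} = space ?R - {Ts. \<delta> / 3 \<le> D Ts G}" by auto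
    ultimately show ?thesis
      using measure_pmf.prob_compl[of "{Ts. \<delta> / 3 \<le> D Ts G}" "replicate_pmf k (stat n G P)"] by simp
  qed
  show "pmf (run G (LSM E k P (\<delta> / 3) n)) True \<ge> 0.99" if G: "G \<in> GSol E n" for G
  proof -
    have "Min (D Ts ` GSol E n) \<le> D Ts G" for Ts
      using G finite_GSol[of E n] by (intro Min_le) auto
    then have sub: "{Ts. D Ts G < \<delta> / 3} \<subseteq> {Ts. Min (D Ts ` GSol E n) \<le> \<delta> / 3}"
      by (intro Collect_mono impI) (meson le_less_trans less_imp_le)
    have "0.99 \<le> measure (measure_pmf (replicate_pmf k (stat n G P)))
        {Ts. Min (D Ts ` GSol E n) \<le> \<delta> / 3}"
      by (rule order_trans[OF close measure_pmf.finite_measure_mono[OF sub]]) simp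
    then show ?thesis by (simp add: run pmf_map vimage_def)
  qed
  show "pmf (run H (LSM E k P (\<delta> / 3) n)) False \<ge> 0.99" if H: "H \<in> GSol_far E \<epsilon> n" for H
  proof -
    have "\<delta> / 3 < D Ts G" if "D Ts H < \<delta> / 3" "G \<in> GSol E n" for Ts G
    proof -
      \<comment> \<open>The triangle inequality through the empirical distribution, term by
        term.\<close>
      have "tv_dist (Pow P) (stat n G P) (stat n H P) \<le> D Ts G + D Ts H"
        unfolding D_def tv_dist_def distrib_left[symmetric] sum.distrib[symmetric]
        by (intro mult_left_mono sum_mono) auto
      then show ?thesis using dist[OF n that(2) H] that(1) \<delta> by simp
    qed
    then have "\<delta> / 3 < Min (D Ts ` GSol E n)" if "D Ts H < \<delta> / 3" for Ts
      using that finite_GSol[of E n] GSol_nonempty[of E n] by (subst Min_gr_iff) auto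
    then have sub: "{Ts. D Ts H < \<delta> / 3} \<subseteq> {Ts. \<not> Min (D Ts ` GSol E n) \<le> \<delta> / 3}"
      by (auto simp only: not_le)
    have "0.99 \<le> measure (measure_pmf (replicate_pmf k (stat n H P)))
        {Ts. \<not> Min (D Ts ` GSol E n) \<le> \<delta> / 3}"
      by (rule order_trans[OF close measure_pmf.finite_measure_mono[OF sub]]) simp
    then show ?thesis by (simp add: run pmf_map vimage_def)
  qed
  show "queries_at_most n G (k * sum_list (map length ws)) (LSM E k P (\<delta> / 3) n)"
    if "G \<in> sgraphs n" for G
    by (rule queries_at_most_LSM[OF that n])
qed

end

section \<open>Choice of parameters and the cycle of implications\<close>

lemma statistically_distinguishable_imp_LSM:
  fixes E :: "('s::finite) relations"
  assumes "statistically_distinguishable E" "\<epsilon> > 0"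
  obtains k P \<delta> q where "k \<ge> 1" "P \<in> fin_subsets reduced_words" "\<delta> > 0"
    "is_tester E \<epsilon> q (LSM E k P \<delta>)"
proof -
  obtain P \<delta> where P: "P \<in> fin_subsets reduced_words" and \<delta>: "\<delta> > 0"
    and dist: "\<And>n G H. \<lbrakk>n \<ge> 1; G \<in> GSol E n; H \<in> GSol_far E \<epsilon> n\<rbrakk> \<Longrightarrow>
      tv_dist (Pow P) (stat n G P) (stat n H P) \<ge> \<delta>"
    using assms unfolding statistically_distinguishable_def by metis
  define k where "k = Suc (nat \<lceil>100 * (real (card (Pow P)))\<^sup>2 / (\<delta> / 3)\<^sup>2\<rceil>)"
  have k: "k \<ge> 1" "100 * (real (card (Pow P)))\<^sup>2 / (\<delta> / 3)\<^sup>2 \<le> real k"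
    unfolding k_def by simp linarith
  show ?thesis
    using that[OF k(1) P _ LSM_is_tester[OF P \<delta> k dist]] \<delta> by simp
qed

theorem theorem3:
  fixes E :: "('s::finite) relations"
  assumes "finite E"
  shows "(testable E \<longleftrightarrow>
            (\<exists>(k :: real \<Rightarrow> nat) (P :: real \<Rightarrow> 's word set) (\<delta> :: real \<Rightarrow> real).
               (\<forall>\<epsilon>>0. k \<epsilon> \<ge> 1 \<and> P \<epsilon> \<in> fin_subsets reduced_words \<and> \<delta> \<epsilon> > 0) \<and>
               family_of_testers E (\<lambda>\<epsilon>. LSM E (k \<epsilon>) (P \<epsilon>) (\<delta> \<epsilon>))))
       \<and> (testable E \<longleftrightarrow> statistically_distinguishable E)"
    (is "(_ \<longleftrightarrow> ?LSM) \<and> _")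
proof -
  have "?LSM" if "statistically_distinguishable E"
  proof -
    \<comment> \<open>The positivity of \<epsilon> is moved inside so that total functions of
      \<epsilon> can be chosen; their values at \<epsilon> \<le> 0 are arbitrary.\<close>
    have "\<forall>\<epsilon>. \<exists>k P \<delta>. \<epsilon> > 0 \<longrightarrow> k \<ge> 1 \<and> P \<in> fin_subsets reduced_words \<and> \<delta> > 0
        \<and> (\<exists>q. is_tester E \<epsilon> q (LSM E k P \<delta>))"
      using statistically_distinguishable_imp_LSM[OF that] by metis
    then obtain k P \<delta> where "\<forall>\<epsilon>>0. k \<epsilon> \<ge> 1 \<and> P \<epsilon> \<in> fin_subsets reduced_words \<and> \<delta> \<epsilon> > 0
        \<and> (\<exists>q. is_tester E \<epsilon> q (LSM E (k \<epsilon>) (P \<epsilon>) (\<delta> \<epsilon>)))"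
      by metis
    then show ?thesis unfolding family_of_testers_def by blast
  qed
  moreover have "testable E" if "?LSM"
    using that unfolding testable_def by blast
  moreover have "statistically_distinguishable E" if "testable E"
    using testable_imp_statistically_distinguishable[OF assms that] .
  ultimately show ?thesis by blast
qed

end
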